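(* Let $A$ be a C*-algebra and let $A'$ be its dual. Then: (1) For $b_{1},b_{2},b_{3},b_{4}\in A$, if $$a\in(b_{1}+A_{+}+iA_{\mathrm{sa}})\cap(b_{2}-A_{+}+iA_{\mathrm{sa}})\cap(b_{3}+iA_{+}+A_{\mathrm{sa}})\cap(b_{4}-iA_{+}+A_{\mathrm{sa}}),$$ then $\|a\|\leq\max\{\|b_{1}\|,\|b_{2}\|\}+\max\{\|b_{3}\|,\|b_{4}\|\}$. (2) For $b_{1},b_{2},b_{3},b_{4}\in A$, if $$a\in(b_{1}+A_{+})\cap(b_{2}-A_{+})\cap(b_{3}+iA_{+})\cap(b_{4}-iA_{+}),$$ then $\|a\|\leq\max\{\|b_{1}\|,\|b_{2}\|\}+\max\{\|b_{3}\|,\|b_{4}\|\}$. (3) For $a,b,c\in A$, if $a\leq b\leq c$, then $\|b\|\leq2\max\{\|a\|,\|c\|\}$. (4) For $a,b,c\in A_{\mathrm{sa}}$, if $a\leq b\leq c$, then $\|b\|\leq\max\{\|a\|,\|c\|\}$. (5) For $\phi_{1},\phi_{2},\phi_{3},\phi_{4}\in A'$, if $$\varphi\in(\phi_{1}+A_{+}'+iA_{\mathrm{sa}}')\cap(\phi_{2}-A_{+}'+iA_{\mathrm{sa}}')\cap(\phi_{3}+iA_{+}'+A_{\mathrm{sa}}')\cap(\phi_{4}-iA_{+}'+A_{\mathrm{sa}}'),$$ then $\|\varphi\|\leq\sum_{j=1}^{4}\|\phi_{j}\|$. (6) For $\phi_{1},\phi_{2},\phi_{3},\phi_{4}\in A'$,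 if $$\varphi\in(\phi_{1}+A_{+}')\cap(\phi_{2}-A_{+}')\cap(\phi_{3}+iA_{+}')\cap(\phi_{4}-iA_{+}'),$$ then $\|\varphi\|\leq\sum_{j=1}^{4}\|\phi_{j}\|$. (7) For $\rho,\phi,\psi\in A'$, if $\rho\leq\phi\leq\psi$, then $\|\phi\|\leq2(\|\rho\|+\|\psi\|)$. (8) For $\rho,\phi,\psi\in A_{\mathrm{sa}}'$, if $\rho\leq\phi\leq\psi$, then $\|\phi\|\leq\|\rho\|+\|\psi\|$.
   Context: For a (complex) C*-algebra $A$ with dual $A'$ (bounded complex-linear functionals on $A$): $A_{+}:=\{a^{*}a:a\in A\}$ is the cone of positive elements; $A_{+}':=\{\phi\in A':\phi(a^{*}a)\geq0\ \forall a\in A\}$ is the cone of positive functionals; $A_{\mathrm{sa}}:=\{a\in A:a=a^{*}\}$ and $A_{\mathrm{sa}}':=\{\phi\in A':\phi(a^{*})=\overline{\phi(a)}\ \forall a\in A\}$ are the real subspaces of self-adjoint elements and self-adjoint functionals. For $a,b\in A$, $a\leq b$ means $b\in a+A_{+}$; for $\phi,\varphi\in A'$, $\phi\leq\varphi$ means $\varphi\in\phi+A_{+}'$. *)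

theory Defs
  imports "HOL-Analysis.Analysis" "HOL-Library.Nonpos_Ints"
begin

(* The distribution has only real vector spaces; the complex ones extend them,
   so that norm, completeness and boundedness are those of the library. *)

class complex_vector = real_vector +
  fixes scaleC :: "complex \<Rightarrow> 'a \<Rightarrow> 'a" (infixr \<open>*\<^sub>C\<close> 75)
  assumes scaleC_add_right: "c *\<^sub>C (x + y) = c *\<^sub>C x + c *\<^sub>C y"
    and scaleC_add_left: "(c + d) *\<^sub>C x = c *\<^sub>C x + d *\<^sub>C x"
    and scaleC_scaleC: "c *\<^sub>C d *\<^sub>C x = (c * d) *\<^sub>C x"
    and scaleC_of_real: "complex_of_real r *\<^sub>C x = r *\<^sub>R x"

class complex_normed_vector = complex_vector + real_normed_vector +
  assumes norm_scaleC: "norm (c *\<^sub>C x) = cmod c * norm x"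

(* No unit is assumed, and the zero algebra is allowed. *)
class cstar_algebra = complex_normed_vector + real_normed_algebra + banach +
  fixes adj :: "'a \<Rightarrow> 'a" (\<open>_\<^sup>\<star>\<close> [1000] 999)
  assumes mult_scaleC_left: "(c *\<^sub>C x) * y = c *\<^sub>C (x * y)"
    and mult_scaleC_right: "x * (c *\<^sub>C y) = c *\<^sub>C (x * y)"
    and adj_adj: "(x\<^sup>\<star>)\<^sup>\<star> = x"
    and adj_add: "(x + y)\<^sup>\<star> = x\<^sup>\<star> + y\<^sup>\<star>"
    and adj_scaleC: "(c *\<^sub>C x)\<^sup>\<star> = cnj c *\<^sub>C x\<^sup>\<star>"
    and adj_mult: "(x * y)\<^sup>\<star> = y\<^sup>\<star> * x\<^sup>\<star>"
    and cstar_identity: "norm (x\<^sup>\<star> * x) = (norm x)\<^sup>2"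

instantiation complex :: cstar_algebra
begin

definition scaleC_complex :: "complex \<Rightarrow> complex \<Rightarrow> complex"
  where "scaleC_complex c z = c * z"

definition adj_complex :: "complex \<Rightarrow> complex"
  where "adj_complex z = cnj z"

instance
proof
  fix c d z w :: complex and r :: real
  show "c *\<^sub>C (z + w) = c *\<^sub>C z + c *\<^sub>C w"
    by (simp add: scaleC_complex_def distrib_left)
  show "(c + d) *\<^sub>C z = c *\<^sub>C z + d *\<^sub>C z"
    by (simp add: scaleC_complex_def distrib_right)
  show "c *\<^sub>C d *\<^sub>C z = (c * d) *\<^sub>C z"
    by (simp add: scaleC_complex_def)
  show "complex_of_real r *\<^sub>C z = r *\<^sub>R z"
    by (simp add: scaleC_complex_def scaleR_conv_of_real)
  show "norm (c *\<^sub>C z) = cmod c * norm z"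
    by (simp add: scaleC_complex_def norm_mult)
  show "(c *\<^sub>C z) * w = c *\<^sub>C (z * w)" "z * (c *\<^sub>C w) = c *\<^sub>C (z * w)"
    by (simp_all add: scaleC_complex_def)
  show "(z\<^sup>\<star>)\<^sup>\<star> = z" "(z + w)\<^sup>\<star> = z\<^sup>\<star> + w\<^sup>\<star>" "(z * w)\<^sup>\<star> = w\<^sup>\<star> * z\<^sup>\<star>"
    by (simp_all add: adj_complex_def)
  show "(c *\<^sub>C z)\<^sup>\<star> = cnj c *\<^sub>C z\<^sup>\<star>"
    by (simp add: adj_complex_def scaleC_complex_def)
  show "norm (z\<^sup>\<star> * z) = (norm z)\<^sup>2"
    by (simp add: adj_complex_def norm_mult power2_eq_square)
qed

end

(* Real-linear maps into a complex space form a complex space; the norm is the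
   operator norm. *)
instantiation blinfun :: (real_normed_vector, complex_normed_vector) complex_normed_vector
begin

lift_definition scaleC_blinfun :: "complex \<Rightarrow> ('a \<Rightarrow>\<^sub>L 'b) \<Rightarrow> ('a \<Rightarrow>\<^sub>L 'b)"
  is "\<lambda>c f x. c *\<^sub>C f x"
proof -
  fix c :: complex and f :: "'a \<Rightarrow> 'b"
  assume "bounded_linear f"
  then interpret bounded_linear f .
  obtain K where K: "\<And>x. norm (f x) \<le> norm x * K" using bounded by blast
  show "bounded_linear (\<lambda>x. c *\<^sub>C f x)"
  proof (rule bounded_linear_intro)
    show "c *\<^sub>C f (x + y) = c *\<^sub>C f x + c *\<^sub>C f y" for x y
      by (simp add: add scaleC_add_right)
    show "c *\<^sub>C f (r *\<^sub>R x) = r *\<^sub>R (c *\<^sub>C f x)" for r x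
      by (simp add: scale scaleC_scaleC mult.commute flip: scaleC_of_real)
    show "norm (c *\<^sub>C f x) \<le> norm x * (cmod c * K)" for x
      using mult_left_mono[OF K[of x] norm_ge_zero[of c]]
      by (simp add: norm_scaleC mult_ac)
  qed
qed

instance
proof
  fix c d :: complex and r :: real and f g :: "'a \<Rightarrow>\<^sub>L 'b"
  show "c *\<^sub>C (f + g) = c *\<^sub>C f + c *\<^sub>C g"
    by transfer (simp add: scaleC_add_right)
  show "(c + d) *\<^sub>C f = c *\<^sub>C f + d *\<^sub>C f"
    by transfer (simp add: scaleC_add_left)
  show "c *\<^sub>C d *\<^sub>C f = (c * d) *\<^sub>C f"
    by transfer (simp add: scaleC_scaleC)
  show "complex_of_real r *\<^sub>C f = r *\<^sub>R f"
    by transfer (simp add: scaleC_of_real)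
  have bound: "norm (b *\<^sub>C h) \<le> cmod b * norm h" for b and h :: "'a \<Rightarrow>\<^sub>L 'b"
  proof (rule norm_blinfun_bound)
    show "norm (blinfun_apply (b *\<^sub>C h) x) \<le> cmod b * norm h * norm x" for x
      using mult_left_mono[OF norm_blinfun[of h x] norm_ge_zero[of b]]
      by (simp add: scaleC_blinfun.rep_eq norm_scaleC mult_ac)
  qed simp
  show "norm (c *\<^sub>C f) = cmod c * norm f"
  proof (cases "c = 0")
    case True
    then show ?thesis using bound[of c f] by simp
  next
    case False
    have "inverse c *\<^sub>C c *\<^sub>C f = f"
      using False scaleC_of_real[of 1]
      by (intro blinfun_eqI) (simp add: scaleC_blinfun.rep_eq scaleC_scaleC)
    then have "norm f \<le> inverse (cmod c) * norm (c *\<^sub>C f)"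
      using bound[of "inverse c" "c *\<^sub>C f"] by (simp add: norm_inverse)
    then show ?thesis
      using bound[of c f] False by (simp add: field_simps)
  qed
qed

end

definition positives :: "'a::cstar_algebra set"
  where "positives = {a\<^sup>\<star> * a | a. True}"

definition selfadjoints :: "'a::cstar_algebra set"
  where "selfadjoints = {a. a = a\<^sup>\<star>}"

definition alg_le :: "'a::cstar_algebra \<Rightarrow> 'a \<Rightarrow> bool" (infix \<open>\<sqsubseteq>\<^sub>A\<close> 50)
  where "a \<sqsubseteq>\<^sub>A b \<longleftrightarrow> b \<in> {a + p | p. p \<in> positives}"

(* The type of blinfuns only gives real-linearity. *)
definition dual_space :: "('a::cstar_algebra \<Rightarrow>\<^sub>L complex) set"
  where "dual_space = {\<phi> :: 'a \<Rightarrow>\<^sub>L complex. \<forall>c x. \<phi> (c *\<^sub>C x) = c * \<phi> x}"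

definition dual_positives :: "('a::cstar_algebra \<Rightarrow>\<^sub>L complex) set"
  where "dual_positives = {\<phi> \<in> dual_space. \<forall>a. \<phi> (a\<^sup>\<star> * a) \<in> \<real>\<^sub>\<ge>\<^sub>0}"

definition dual_selfadjoints :: "('a::cstar_algebra \<Rightarrow>\<^sub>L complex) set"
  where "dual_selfadjoints = {\<phi> \<in> dual_space. \<forall>a. \<phi> (a\<^sup>\<star>) = cnj (\<phi> a)}"

definition dual_le ::
    "('a::cstar_algebra \<Rightarrow>\<^sub>L complex) \<Rightarrow> ('a \<Rightarrow>\<^sub>L complex) \<Rightarrow> bool" (infix \<open>\<sqsubseteq>\<^sub>D\<close> 50)
  where "\<phi> \<sqsubseteq>\<^sub>D \<psi> \<longleftrightarrow> \<psi> \<in> {\<phi> + \<rho> | \<rho>. \<rho> \<in> dual_positives}"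

end

theory Submission
  imports Defs
begin

text \<open>
  All eight estimates reduce to two facts about a \<open>C\<^sup>*\<close>-algebra \<open>A\<close>.

  \<^item> Order intervals (\<open>norm_le_max_if_between\<close>): if \<open>a \<le> b \<le> c\<close> are self-adjoint, then
    \<open>norm b \<le> max (norm a) (norm c)\<close>.  In a unital algebra this follows from
    \<open>- norm a \<le> a \<le> b \<le> c \<le> norm c\<close>.
  \<^item> Jordan decomposition (\<open>selfadjoint_eq_diff_positives\<close>): a self-adjoint \<open>a\<close> has the form
    \<open>x\<^sup>\<star> x - y\<^sup>\<star> y\<close> with both terms of norm at most \<open>norm a\<close>.

  For elements, the order relations in the statement say that the real and imaginary parts of
  \<open>a\<close> lie between those of the given elements, and the first fact is applied to both parts.
  For functionals, \<open>\<phi>\<^sub>1 \<le> \<psi> \<le> \<phi>\<^sub>2\<close> and the decomposition of a self-adjoint \<open>a\<close> give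
  \<open>Re (\<psi> a) \<le> Re (\<phi>\<^sub>2 (x\<^sup>\<star> x)) - Re (\<phi>\<^sub>1 (y\<^sup>\<star> y)) \<le> (norm \<phi>\<^sub>1 + norm \<phi>\<^sub>2) * norm a\<close>, likewise for imaginary
  parts, and a rotation of the argument passes from self-adjoint elements to all of them.

  The two facts are proved without spectral theory or functional calculus.  The only analytic
  tool is the binomial series of \<open>sqrt (1 - t)\<close>, which converges absolutely on the closed unit disc and so
  gives a square root of every self-adjoint \<open>T\<close> with \<open>norm (1 - T) \<le> 1\<close> (\<open>contractive_sqrt\<close>).
  Nonnegativity of a self-adjoint \<open>T\<close> is expressed by \<open>norm (t - T) \<le> t\<close> for some \<open>t\<close>
  (\<open>spectrally_nonneg\<close>).  Square roots give unitaries \<open>s + \<i> c\<close> with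
  \<open>s\<^sup>2 + c\<^sup>2 = 1\<close>, from which the norm estimates follow, and absolute values
  \<open>\<bar>h\<bar> = sqrt (h\<^sup>2)\<close>, from which the decomposition follows.  The deepest point is that \<open>x\<^sup>\<star> x\<close> is nonnegative in
  this sense (\<open>spectrally_nonneg_adj_mult_self\<close>).

  These arguments need a unit, which \<open>A\<close> may lack.  They are therefore carried out in the algebra of
  adjointable operators on \<open>A\<close>, its multiplier algebra, in which \<open>A\<close> sits isometrically as a closed
  left ideal.
\<close>

section \<open>The involution, real and imaginary parts\<close>

lemma scaleC_one [simp]: "1 *\<^sub>C x = (x :: 'a::complex_vector)"
  using scaleC_of_real[of 1 x] by simp

lemma scaleC_minus_one [simp]: "(-1) *\<^sub>C x = - (x :: 'a::complex_vector)"
  using scaleC_of_real[of "-1" x] by simp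

lemma scaleC_zero_right [simp]: "c *\<^sub>C 0 = (0 :: 'a::complex_vector)"
  using scaleC_add_right[of c 0 "0::'a"] by simp

lemma scaleC_minus_right: "c *\<^sub>C (- x) = - (c *\<^sub>C (x :: 'a::complex_vector))"
  using scaleC_add_right[of c x "-x"] by (simp add: eq_neg_iff_add_eq_0 add.commute)

lemma scaleC_diff_right: "c *\<^sub>C (x - y) = c *\<^sub>C x - c *\<^sub>C (y :: 'a::complex_vector)"
  using scaleC_add_right[of c x "-y"] by (simp add: scaleC_minus_right)

lemma scaleC_minus_left: "(- c) *\<^sub>C x = - (c *\<^sub>C (x :: 'a::complex_vector))"
  using scaleC_scaleC[of "-1" c x] by simp

lemma scaleC_scaleR: "c *\<^sub>C r *\<^sub>R x = r *\<^sub>R c *\<^sub>C (x :: 'a::complex_vector)"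
  by (simp add: scaleC_scaleC mult.commute flip: scaleC_of_real)

lemma adj_scaleR: "(r *\<^sub>R x)\<^sup>\<star> = r *\<^sub>R (x :: 'a::cstar_algebra)\<^sup>\<star>"
  using adj_scaleC[of "complex_of_real r" x] by (simp add: scaleC_of_real)

lemma adj_zero [simp]: "(0 :: 'a::cstar_algebra)\<^sup>\<star> = 0"
  using adj_scaleR[of 0 "0::'a"] by simp

lemma adj_minus: "(- x)\<^sup>\<star> = - (x :: 'a::cstar_algebra)\<^sup>\<star>"
  using adj_scaleR[of "-1" x] by simp

lemma adj_diff: "(x - y)\<^sup>\<star> = x\<^sup>\<star> - (y :: 'a::cstar_algebra)\<^sup>\<star>"
  using adj_add[of x "-y"] by (simp add: adj_minus)

lemma adj_mult_self_eq_zero_iff: "x\<^sup>\<star> * x = 0 \<longleftrightarrow> (x :: 'a::cstar_algebra) = 0"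
  using cstar_identity[of x] by auto

lemma norm_adj [simp]: "norm (x\<^sup>\<star>) = norm (x :: 'a::cstar_algebra)"
proof -
  have le: "norm y \<le> norm (y\<^sup>\<star>)" for y :: 'a
    using norm_mult_ineq[of "y\<^sup>\<star>" y] cstar_identity[of y]
    by (cases "y = 0") (simp_all add: power2_eq_square)
  show ?thesis using le[of x] le[of "x\<^sup>\<star>"] by (simp add: adj_adj)
qed

lemma bounded_linear_adj: "bounded_linear (adj :: 'a::cstar_algebra \<Rightarrow> 'a)"
  by (rule bounded_linear_intro[where K = 1]) (simp_all add: adj_add adj_scaleR)

lemma norm_square_selfadjoint: "s\<^sup>\<star> = s \<Longrightarrow> norm (s * s) = (norm (s :: 'a::cstar_algebra))\<^sup>2"
  using cstar_identity[of s] by simp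

lemma square_eq_zero_selfadjoint: "s\<^sup>\<star> = s \<Longrightarrow> s * s = 0 \<longleftrightarrow> (s :: 'a::cstar_algebra) = 0"
  using adj_mult_self_eq_zero_iff[of s] by simp

definition re_part :: "'a::cstar_algebra \<Rightarrow> 'a"
  where "re_part x = (1/2) *\<^sub>R (x + x\<^sup>\<star>)"

definition im_part :: "'a::cstar_algebra \<Rightarrow> 'a"
  where "im_part x = (1/2) *\<^sub>R (- \<i> *\<^sub>C (x - x\<^sup>\<star>))"

lemma adj_re_part [simp]: "(re_part x)\<^sup>\<star> = re_part x"
  by (simp add: re_part_def adj_scaleR adj_add adj_adj add.commute)

lemma adj_im_part [simp]: "(im_part x)\<^sup>\<star> = im_part x"
  by (simp add: im_part_def adj_scaleR adj_scaleC adj_diff adj_adj scaleC_diff_right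
      scaleC_minus_left)

lemma re_im_decomposition: "x = re_part x + \<i> *\<^sub>C im_part x"
  by (simp add: re_part_def im_part_def scaleC_scaleC flip: scaleC_of_real)
     (simp add: scaleC_scaleC scaleC_add_right scaleC_diff_right flip: scaleC_add_left)

lemma norm_re_part: "norm (re_part x) \<le> norm x"
  using norm_triangle_ineq[of x "x\<^sup>\<star>"] by (simp add: re_part_def)

lemma norm_im_part: "norm (im_part x) \<le> norm x"
  using norm_triangle_ineq4[of x "x\<^sup>\<star>"] by (simp add: im_part_def norm_scaleC)

lemma re_part_add: "re_part (x + y) = re_part x + re_part y"
  by (simp add: re_part_def adj_add scaleR_add_right)

lemma im_part_add: "im_part (x + y) = im_part x + im_part y"
  by (simp add: im_part_def adj_add scaleC_diff_right scaleC_add_right algebra_simps)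

lemma re_part_diff: "re_part (x - y) = re_part x - re_part y"
  using re_part_add[of "x - y" y] by simp

lemma im_part_diff: "im_part (x - y) = im_part x - im_part y"
  using im_part_add[of "x - y" y] by simp

lemma re_part_imaginary: "s\<^sup>\<star> = s \<Longrightarrow> re_part (\<i> *\<^sub>C s) = 0"
  by (simp add: re_part_def adj_scaleC scaleC_minus_left)

lemma re_part_selfadjoint: "s\<^sup>\<star> = s \<Longrightarrow> re_part s = s"
  by (simp add: re_part_def flip: scaleR_2)

lemma im_part_selfadjoint: "s\<^sup>\<star> = s \<Longrightarrow> im_part s = 0"
  by (simp add: im_part_def)

lemma im_part_imaginary: "s\<^sup>\<star> = s \<Longrightarrow> im_part (\<i> *\<^sub>C s) = s"
  by (simp add: im_part_def adj_scaleC scaleC_minus_left scaleC_scaleC scaleC_scaleR flip: scaleR_2)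

section \<open>Unital algebras\<close>

text \<open>The class \<^class>\<open>monoid_mult\<close> leaves room for \<open>1 = 0\<close>, which is what happens
  in the multiplier algebra of the zero algebra.\<close>
class unital_cstar_algebra = cstar_algebra + monoid_mult

lemma adj_one [simp]: "(1 :: 'a::unital_cstar_algebra)\<^sup>\<star> = 1"
  by (metis adj_adj adj_mult mult_1_left mult_1_right)

lemma norm_one_le: "norm (1 :: 'a::unital_cstar_algebra) \<le> 1"
  using cstar_identity[of "1::'a"] by (cases "norm (1::'a) = 0") (simp_all add: power2_eq_square)

lemma norm_power_le_one: "norm x \<le> 1 \<Longrightarrow> norm (x ^ n) \<le> 1" for x :: "'a::unital_cstar_algebra"
proof (induction n)
  case (Suc n)
  then have "norm x * norm (x ^ n) \<le> 1 * 1" by (intro mult_mono) auto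
  then show ?case using norm_mult_ineq[of x "x ^ n"] by simp
qed (simp add: norm_one_le)

lemma adj_power: "(x ^ n)\<^sup>\<star> = (x\<^sup>\<star>) ^ n" for x :: "'a::unital_cstar_algebra"
  by (induction n) (simp_all add: adj_mult power_commutes)

text \<open>In this situation \<open>s + \<i> c\<close> is \<open>M\<close> times a unitary, so its norm is at most \<open>M\<close>, and
  \<open>s\<close> is its real part.  The norm estimates for order intervals come from here, the partner \<open>c\<close> being a square root of \<open>M\<^sup>2 - s\<^sup>2\<close>.\<close>
lemma norm_le_if_squares_sum:
  fixes s c :: "'a::unital_cstar_algebra"
  assumes "s\<^sup>\<star> = s" "c\<^sup>\<star> = c" "s * c = c * s" "s * s + c * c = (M\<^sup>2) *\<^sub>R 1" "0 \<le> M"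
  shows "norm s \<le> M"
proof -
  define u where "u = s + \<i> *\<^sub>C c"
  have ua: "u\<^sup>\<star> = s - \<i> *\<^sub>C c"
    by (simp add: u_def adj_add adj_scaleC assms scaleC_minus_left)
  have "u\<^sup>\<star> * u = s * s + c * c"
    unfolding ua by (simp add: u_def algebra_simps mult_scaleC_left mult_scaleC_right
        scaleC_scaleC scaleC_diff_right scaleC_minus_left assms(3))
  then have "(norm u)\<^sup>2 \<le> M\<^sup>2"
    using cstar_identity[of u] mult_left_le[OF norm_one_le[where 'a = 'a], of "M\<^sup>2"] assms(4)
    by simp
  then have "norm u \<le> M" using assms(5) by (simp add: power2_le_iff_abs_le)
  moreover have "re_part u = s" using assms(1,2)
    by (simp add: u_def re_part_add re_part_selfadjoint re_part_imaginary)
  ultimately show ?thesis using norm_re_part[of u] by simp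
qed

section \<open>The binomial series of the square root\<close>

text \<open>The Taylor coefficients of \<open>\<lambda>t. sqrt (1 - t)\<close> at \<open>0\<close>.\<close>
definition sqrt_coeff :: "nat \<Rightarrow> real"
  where "sqrt_coeff n = (-1) ^ n * ((1/2) gchoose n)"

lemma sqrt_coeff_0 [simp]: "sqrt_coeff 0 = 1"
  by (simp add: sqrt_coeff_def)

lemma sqrt_coeff_Suc: "sqrt_coeff (Suc n) = sqrt_coeff n * (real n - 1/2) / (real n + 1)"
proof -
  have "((1/2::real) gchoose Suc n) = (1/2 - real n) / (real n + 1) * ((1/2) gchoose n)"
    using gbinomial_mult_1[of "1/2::real" n] by (simp add: field_simps)
  then show ?thesis unfolding sqrt_coeff_def by (simp only:) (simp add: field_simps)
qed

lemma sqrt_coeff_Suc_nonpos: "sqrt_coeff (Suc n) \<le> 0"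
proof (induction n)
  case (Suc n)
  then show ?case
    by (subst sqrt_coeff_Suc) (auto intro!: divide_nonpos_pos mult_nonpos_nonneg)
qed (simp add: sqrt_coeff_Suc)

lemma sum_sqrt_coeff: "(\<Sum>k\<le>n. sqrt_coeff k) = (-1) ^ n * ((-1/2) gchoose n)"
  using gbinomial_sum_lower_neg[of "1/2::real" n] by (simp add: sqrt_coeff_def mult.commute)

lemma sum_sqrt_coeff_nonneg: "0 \<le> (\<Sum>k\<le>n. sqrt_coeff k)"
proof -
  have "0 \<le> (-1) ^ n * ((-1/2::real) gchoose n)"
  proof (induction n)
    case (Suc n)
    have "((-1/2::real) gchoose Suc n) = (-1/2 - real n) / (real n + 1) * ((-1/2) gchoose n)"
      using gbinomial_mult_1[of "-1/2::real" n] by (simp add: field_simps)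
    then have "(-1) ^ Suc n * ((-1/2::real) gchoose Suc n)
        = (1/2 + real n) / (real n + 1) * ((-1) ^ n * ((-1/2) gchoose n))"
      by (simp only:) (simp add: field_simps)
    then show ?case using Suc by simp
  qed simp
  then show ?thesis by (simp only: sum_sqrt_coeff)
qed

text \<open>All coefficients but the first are nonpositive and the partial sums never become negative,
  so the series converges absolutely even on the boundary of the unit disc.  This allows roots
  of non-invertible elements, and the bound \<open>1\<close> gives the square root the same distance
  estimate from \<open>1\<close> as the element had.\<close>
lemma sum_abs_sqrt_coeff_Suc: "(\<Sum>k<n. \<bar>sqrt_coeff (Suc k)\<bar>) \<le> 1"
proof -
  have "(\<Sum>k<n. \<bar>sqrt_coeff (Suc k)\<bar>) = - (\<Sum>k<n. sqrt_coeff (Suc k))"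
    by (simp add: sqrt_coeff_Suc_nonpos sum_negf abs_of_nonpos)
  also have "\<dots> = 1 - (\<Sum>k\<le>n. sqrt_coeff k)"
    by (simp only: sum.atMost_shift sqrt_coeff_0)
  finally show ?thesis using sum_sqrt_coeff_nonneg[of n] by simp
qed

lemma summable_abs_sqrt_coeff_Suc: "summable (\<lambda>n. \<bar>sqrt_coeff (Suc n)\<bar>)"
  by (rule summableI_nonneg_bounded[OF _ sum_abs_sqrt_coeff_Suc]) simp

lemma summable_abs_sqrt_coeff: "summable (\<lambda>n. \<bar>sqrt_coeff n\<bar>)"
  using summable_abs_sqrt_coeff_Suc summable_Suc_iff by blast

text \<open>Vandermonde's identity for \<open>1/2 + 1/2 = 1\<close>: squaring the series gives \<open>1 - t\<close>.\<close>
lemma sqrt_coeff_convolution: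
  "(\<Sum>i\<le>k. sqrt_coeff i * sqrt_coeff (k - i)) = (if k = 0 then 1 else if k = 1 then -1 else 0)"
proof -
  have "(\<Sum>i\<le>k. sqrt_coeff i * sqrt_coeff (k - i))
      = (-1) ^ k * (\<Sum>i=0..k. ((1/2) gchoose i) * ((1/2) gchoose (k - i)))"
    unfolding sum_distrib_left atMost_atLeast0
    by (intro sum.cong) (auto simp: sqrt_coeff_def mult_ac simp flip: power_add)
  also have "\<dots> = (-1) ^ k * ((1::real) gchoose k)"
    by (simp add: gbinomial_Vandermonde)
  also have "(1::real) gchoose k = of_nat (1 choose k)"
    using binomial_gbinomial[of 1 k, where 'a = real] by simp
  finally show ?thesis by (cases k) (auto simp: binomial_eq_0)
qed

lemma sqrt_series_squared:
  fixes R :: "'a::{real_normed_algebra,banach,monoid_mult}"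
  assumes bd: "\<And>n. norm (R ^ n) \<le> 1"
  shows "(\<Sum>n. sqrt_coeff n *\<^sub>R R ^ n) * (\<Sum>n. sqrt_coeff n *\<^sub>R R ^ n) = 1 - R"
proof -
  have sm: "summable (\<lambda>n. norm (sqrt_coeff n *\<^sub>R R ^ n))"
    by (rule summable_comparison_test'[OF summable_abs_sqrt_coeff, of 0])
       (simp add: mult_left_le bd)
  have "(\<Sum>i\<le>k. (sqrt_coeff i *\<^sub>R R ^ i) * (sqrt_coeff (k - i) *\<^sub>R R ^ (k - i)))
      = (if k = 0 then 1 else if k = 1 then - R else 0)" for k
  proof -
    have "(\<Sum>i\<le>k. (sqrt_coeff i *\<^sub>R R ^ i) * (sqrt_coeff (k - i) *\<^sub>R R ^ (k - i)))
        = (\<Sum>i\<le>k. sqrt_coeff i * sqrt_coeff (k - i)) *\<^sub>R R ^ k"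
      unfolding scaleR_sum_left
      by (intro sum.cong) (auto simp: mult.commute simp flip: power_add)
    then show ?thesis by (simp add: sqrt_coeff_convolution)
  qed
  then have "(\<lambda>k. if k = 0 then 1 else if k = 1 then - R else 0) sums
      ((\<Sum>n. sqrt_coeff n *\<^sub>R R ^ n) * (\<Sum>n. sqrt_coeff n *\<^sub>R R ^ n))"
    using Cauchy_product_sums[OF sm sm] by simp
  moreover have "(\<lambda>k. if k = 0 then 1 else if k = 1 then - R else 0) sums
      (\<Sum>k\<in>{0,1::nat}. if k = 0 then 1 else if k = 1 then - R else 0)"
    by (rule sums_finite) auto
  ultimately show ?thesis using sums_unique2 by fastforce
qed

text \<open>The value of the series at \<open>t = 1\<close>, where the square root vanishes.\<close>
lemma suminf_sqrt_coeff: "(\<Sum>n. sqrt_coeff n) = 0"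
  using sqrt_series_squared[of "1::real"] by simp

section \<open>Square roots near the unit\<close>

text \<open>A \<open>C\<^sup>*\<close>-algebra is a closed left ideal of its multiplier algebra.  Knowing that square roots
  stay inside such ideals is what brings elements constructed with the help of a unit back into
  an algebra without one.\<close>
definition closed_left_ideal :: "'a::cstar_algebra set \<Rightarrow> bool"
  where "closed_left_ideal I \<longleftrightarrow> closed I \<and> subspace I \<and> (\<forall>x. \<forall>y\<in>I. x * y \<in> I)"

text \<open>The root is the binomial series in \<open>1 - T\<close>.  The hypothesis covers exactly the closed unit
  ball around \<open>1\<close>, where the series still converges absolutely.  Since the coefficients sum to
  \<open>0\<close>, the powers of \<open>1 - T\<close> may be replaced by their differences from \<open>1\<close>, which are
  left multiples of \<open>T\<close>; hence the statement about ideals.\<close>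
lemma contractive_sqrt:
  fixes T :: "'a::unital_cstar_algebra"
  assumes "T\<^sup>\<star> = T" "norm (1 - T) \<le> 1"
  obtains S where "S\<^sup>\<star> = S" "S * S = T" "norm (1 - S) \<le> 1"
    "\<And>x. x * T = T * x \<Longrightarrow> x * S = S * x"
    "\<And>I. closed_left_ideal I \<Longrightarrow> T \<in> I \<Longrightarrow> S \<in> I"
proof -
  define R where "R = 1 - T"
  define f where "f n = sqrt_coeff n *\<^sub>R R ^ n" for n
  define S where "S = suminf f"
  have Rn: "norm (R ^ n) \<le> 1" for n
    using assms(2) by (simp add: R_def norm_power_le_one)
  have nf: "norm (f n) \<le> \<bar>sqrt_coeff n\<bar>" for n
    by (simp add: f_def mult_left_le Rn)
  have sf: "summable f"
    by (rule summable_comparison_test'[OF summable_abs_sqrt_coeff, of 0]) (rule nf)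
  have Sf: "f sums S" using sf by (simp add: S_def summable_sums)
  have selfadj: "S\<^sup>\<star> = S"
  proof -
    have "(\<lambda>n. (f n)\<^sup>\<star>) sums S\<^sup>\<star>"
      by (rule bounded_linear.sums[OF bounded_linear_adj Sf])
    moreover have "(f n)\<^sup>\<star> = f n" for n
      using assms(1) by (simp add: f_def R_def adj_scaleR adj_power adj_diff)
    ultimately show ?thesis using Sf sums_unique2 by auto
  qed
  have square: "S * S = T"
    using sqrt_series_squared[OF Rn] by (simp add: S_def f_def[abs_def] R_def)
  have contr: "norm (1 - S) \<le> 1"
  proof -
    have "(\<lambda>n. f (Suc n)) sums (S - 1)"
      using Sf sums_Suc_iff[of f "S - 1"] by (simp add: f_def)
    then have "norm (S - 1) \<le> (\<Sum>n. \<bar>sqrt_coeff (Suc n)\<bar>)"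
      using norm_suminf_le[OF nf summable_abs_sqrt_coeff_Suc] by (simp add: sums_iff)
    also have "\<dots> \<le> 1"
      by (rule suminf_le_const[OF summable_abs_sqrt_coeff_Suc sum_abs_sqrt_coeff_Suc])
    finally show ?thesis by (simp add: norm_minus_commute)
  qed
  have comm: "x * S = S * x" if "x * T = T * x" for x
  proof -
    have "x * R = R * x" using that by (simp add: R_def algebra_simps)
    then have "R ^ n * x = x * R ^ n" for n by (metis power_commuting_commutes)
    then have "(\<lambda>n. x * f n) = (\<lambda>n. f n * x)" by (simp add: f_def)
    then show ?thesis
      using sums_unique2[OF sums_mult[OF Sf, of x]] sums_mult2[OF Sf, of x] by simp
  qed
  have ideal: "S \<in> I" if "closed_left_ideal I" "T \<in> I" for I
  proof -
    have I: "closed I" "subspace I" "\<And>x y. y \<in> I \<Longrightarrow> x * y \<in> I" "T \<in> I"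
      using that by (auto simp: closed_left_ideal_def)
    have "R ^ n - 1 \<in> I" for n
    proof (induction n)
      case (Suc n)
      have "R ^ Suc n - 1 = R * (R ^ n - 1) - T" by (simp add: R_def algebra_simps)
      then show ?case using I Suc by (simp add: subspace_diff)
    qed (simp add: I subspace_0)
    then have g: "(\<Sum>k<n. sqrt_coeff k *\<^sub>R (R ^ k - 1)) \<in> I" for n
      using I by (intro subspace_sum subspace_scale)
    have "sqrt_coeff sums 0"
      using summable_rabs_cancel[OF summable_abs_sqrt_coeff] suminf_sqrt_coeff by (simp add: sums_iff)
    then have "(\<lambda>n. f n - sqrt_coeff n *\<^sub>R 1) sums (S - 0 *\<^sub>R 1)"
      by (intro sums_diff Sf sums_scaleR_left)
    then have "(\<lambda>n. sqrt_coeff n *\<^sub>R (R ^ n - 1)) sums S"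
      by (simp add: f_def scaleR_diff_right)
    then show ?thesis
      unfolding sums_def using closed_sequentially[OF I(1), of "\<lambda>n. \<Sum>k<n. sqrt_coeff k *\<^sub>R (R ^ k - 1)"] g by auto
  qed
  show thesis by (rule that[OF selfadj square contr comm ideal])
qed

section \<open>Spectrally nonnegative elements\<close>

text \<open>For a self-adjoint element this says that its spectrum lies in \<open>[0, 2 t]\<close> for some \<open>t\<close>.  In
  this form the triangle inequality shows that sums are nonnegative again, and the
  square root series applies after division by \<open>t\<close>.\<close>
definition spectrally_nonneg :: "'a::unital_cstar_algebra \<Rightarrow> bool"
  where "spectrally_nonneg T \<longleftrightarrow> T\<^sup>\<star> = T \<and> (\<exists>t\<ge>0. norm (t *\<^sub>R 1 - T) \<le> t)"

lemma spectrally_nonneg_selfadjoint: "spectrally_nonneg T \<Longrightarrow> T\<^sup>\<star> = T"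
  by (simp add: spectrally_nonneg_def)

lemma spectrally_nonneg_add:
  assumes "spectrally_nonneg S" "spectrally_nonneg T"
  shows "spectrally_nonneg (S + T)"
proof -
  obtain s t where st: "s \<ge> 0" "norm (s *\<^sub>R 1 - S) \<le> s" "t \<ge> 0" "norm (t *\<^sub>R 1 - T) \<le> t"
    using assms by (auto simp: spectrally_nonneg_def)
  have "(s + t) *\<^sub>R 1 - (S + T) = (s *\<^sub>R 1 - S) + (t *\<^sub>R 1 - T)"
    by (simp add: scaleR_add_left)
  then have "norm ((s + t) *\<^sub>R 1 - (S + T)) \<le> norm (s *\<^sub>R 1 - S) + norm (t *\<^sub>R 1 - T)"
    by (metis norm_triangle_ineq)
  then have "norm ((s + t) *\<^sub>R 1 - (S + T)) \<le> s + t"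
    using st by linarith
  then show ?thesis
    using assms st unfolding spectrally_nonneg_def by (auto simp: adj_add intro!: exI[of _ "s + t"])
qed

lemma spectrally_nonneg_scaleR:
  assumes "spectrally_nonneg T" "0 \<le> r"
  shows "spectrally_nonneg (r *\<^sub>R T)"
proof -
  obtain t where t: "t \<ge> 0" "norm (t *\<^sub>R 1 - T) \<le> t"
    using assms by (auto simp: spectrally_nonneg_def)
  have "norm ((r * t) *\<^sub>R 1 - r *\<^sub>R T) = r * norm (t *\<^sub>R 1 - T)"
    using assms(2) by (simp flip: scaleR_scaleR scaleR_diff_right)
  also have "\<dots> \<le> r * t" using t assms(2) by (simp add: mult_left_mono)
  finally show ?thesis
    using assms t unfolding spectrally_nonneg_def by (auto simp: adj_scaleR intro!: exI[of _ "r * t"])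
qed

lemma spectrally_nonneg_shift:
  assumes "c\<^sup>\<star> = c" "norm c \<le> M"
  shows "spectrally_nonneg (M *\<^sub>R 1 + c)"
  using assms order_trans[OF norm_ge_zero assms(2)] unfolding spectrally_nonneg_def
  by (auto simp: adj_add adj_scaleR intro!: exI[of _ M])

text \<open>After normalising, \<open>norm s = 1\<close>.  Then \<open>c = sqrt (1 - s\<^sup>2)\<close> exists and \<open>s\<^sup>2 + c\<^sup>2 = 1\<close>, so \<open>c\<close> is a
  contraction and so is \<open>1 - s\<^sup>2 = c\<^sup>2\<close>.\<close>
lemma spectrally_nonneg_square:
  assumes "s\<^sup>\<star> = s"
  shows "spectrally_nonneg (s * s)"
proof (cases "s = 0")
  case True
  then show ?thesis by (auto simp: spectrally_nonneg_def intro!: exI[of _ 0])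
next
  case False
  define v where "v = (1 / norm s) *\<^sub>R s"
  have v: "v\<^sup>\<star> = v" "norm v = 1" using assms False by (simp_all add: v_def adj_scaleR)
  have "norm (v * v) \<le> 1" using v by (simp add: norm_square_selfadjoint)
  then have contr: "norm (1 - (1 - v * v)) \<le> 1" by simp
  have adj: "(1 - v * v)\<^sup>\<star> = 1 - v * v" using v by (simp add: adj_diff adj_mult)
  obtain c where c: "c\<^sup>\<star> = c" "c * c = 1 - v * v"
      "\<And>x. x * (1 - v * v) = (1 - v * v) * x \<Longrightarrow> x * c = c * x"
    by (rule contractive_sqrt[OF adj contr]) (rule that)
  have cv: "c * v = v * c" by (rule c(3)[symmetric]) (simp add: algebra_simps)
  have "norm c \<le> 1"
    by (rule norm_le_if_squares_sum[OF c(1) v(1) cv]) (simp_all add: c(2))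
  then have "norm (1 - v * v) \<le> 1"
    using c(2) norm_square_selfadjoint[OF c(1)] by (simp add: power_le_one)
  then have "spectrally_nonneg (v * v)"
    using v by (auto simp: spectrally_nonneg_def adj_mult intro!: exI[of _ 1])
  then have "spectrally_nonneg ((norm s)\<^sup>2 *\<^sub>R (v * v))"
    by (rule spectrally_nonneg_scaleR) simp
  then show ?thesis using False by (simp add: v_def power2_eq_square)
qed

lemma spectrally_nonneg_sqrt:
  fixes T :: "'a::unital_cstar_algebra"
  assumes "spectrally_nonneg T"
  obtains S where "spectrally_nonneg S" "S\<^sup>\<star> = S" "S * S = T"
    "\<And>x. x * T = T * x \<Longrightarrow> x * S = S * x"
    "\<And>I. closed_left_ideal I \<Longrightarrow> T \<in> I \<Longrightarrow> S \<in> I"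
proof -
  obtain t where t: "t \<ge> 0" "norm (t *\<^sub>R 1 - T) \<le> t" and T: "T\<^sup>\<star> = T"
    using assms by (auto simp: spectrally_nonneg_def)
  \<comment> \<open>One may be added to \<open>t\<close> at will, which makes the scaling factor nonzero.\<close>
  define r where "r = t + 1"
  have r: "r > 0" using t by (simp add: r_def)
  have "norm (r *\<^sub>R 1 - T) \<le> r"
    using norm_triangle_ineq[of "t *\<^sub>R 1 - T" 1] t norm_one_le[where 'a = 'a]
    by (simp add: r_def scaleR_add_left algebra_simps)
  moreover have "1 - (1 / r) *\<^sub>R T = (1 / r) *\<^sub>R (r *\<^sub>R 1 - T)"
    using r by (simp add: scaleR_diff_right)
  ultimately have contr: "norm (1 - (1 / r) *\<^sub>R T) \<le> 1" using r by simp
  have adj: "((1 / r) *\<^sub>R T)\<^sup>\<star> = (1 / r) *\<^sub>R T" using T by (simp add: adj_scaleR)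
  obtain S where S: "S\<^sup>\<star> = S" "S * S = (1 / r) *\<^sub>R T" "norm (1 - S) \<le> 1"
    and comm: "\<And>x. x * ((1 / r) *\<^sub>R T) = ((1 / r) *\<^sub>R T) * x \<Longrightarrow> x * S = S * x"
    and ideal: "\<And>I. closed_left_ideal I \<Longrightarrow> (1 / r) *\<^sub>R T \<in> I \<Longrightarrow> S \<in> I"
    by (rule contractive_sqrt[OF adj contr]) (rule that)
  have pos: "spectrally_nonneg S"
    using S by (auto simp: spectrally_nonneg_def intro!: exI[of _ 1])
  show thesis
  proof (rule that[of "sqrt r *\<^sub>R S"])
    show "spectrally_nonneg (sqrt r *\<^sub>R S)"
      using pos r by (simp add: spectrally_nonneg_scaleR)
    show "(sqrt r *\<^sub>R S)\<^sup>\<star> = sqrt r *\<^sub>R S" using S by (simp add: adj_scaleR)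
    show "(sqrt r *\<^sub>R S) * (sqrt r *\<^sub>R S) = T" using S r by simp
    show "x * (sqrt r *\<^sub>R S) = (sqrt r *\<^sub>R S) * x" if "x * T = T * x" for x
      using comm[of x] that by simp
    show "sqrt r *\<^sub>R S \<in> I" if "closed_left_ideal I" "T \<in> I" for I
      using ideal[of I] that by (simp add: closed_left_ideal_def subspace_scale)
  qed
qed

text \<open>The product of the commuting roots of \<open>M - b\<close> and \<open>M + b\<close> is a root of \<open>M\<^sup>2 - b\<^sup>2\<close>.\<close>
lemma norm_le_if_spectrally_between:
  assumes "b\<^sup>\<star> = b" "spectrally_nonneg (M *\<^sub>R 1 - b)" "spectrally_nonneg (M *\<^sub>R 1 + b)" "0 \<le> M"
  shows "norm b \<le> M"
proof -
  obtain p where p: "p\<^sup>\<star> = p" "p * p = M *\<^sub>R 1 - b"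
      "\<And>x. x * (M *\<^sub>R 1 - b) = (M *\<^sub>R 1 - b) * x \<Longrightarrow> x * p = p * x"
    by (rule spectrally_nonneg_sqrt[OF assms(2)]) blast
  obtain q where q: "q\<^sup>\<star> = q" "q * q = M *\<^sub>R 1 + b"
      "\<And>x. x * (M *\<^sub>R 1 + b) = (M *\<^sub>R 1 + b) * x \<Longrightarrow> x * q = q * x"
    by (rule spectrally_nonneg_sqrt[OF assms(3)]) blast
  have bp: "b * p = p * b" by (rule p(3)) (simp add: algebra_simps)
  have bq: "b * q = q * b" by (rule q(3)) (simp add: algebra_simps)
  have pq: "p * q = q * p" by (rule q(3)) (simp add: algebra_simps bp)
  have "(p * q) * (p * q) = (p * p) * (q * q)" by (metis pq mult.assoc)
  also have "\<dots> = (M\<^sup>2) *\<^sub>R 1 - b * b"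
    by (simp add: p(2) q(2) algebra_simps power2_eq_square)
  finally have "b * b + (p * q) * (p * q) = (M\<^sup>2) *\<^sub>R 1" by simp
  moreover have "(p * q)\<^sup>\<star> = p * q" by (simp add: adj_mult p(1) q(1) pq)
  moreover have "b * (p * q) = (p * q) * b" by (metis bp bq mult.assoc)
  ultimately show ?thesis
    using norm_le_if_squares_sum[of b "p * q" M] assms by simp
qed

lemma spectrally_nonneg_antisym:
  assumes "spectrally_nonneg b" "spectrally_nonneg (- b)"
  shows "b = 0"
  using norm_le_if_spectrally_between[of b 0] assms spectrally_nonneg_selfadjoint[OF assms(1)]
  by simp

text \<open>With \<open>M\<close> the larger of the two norms, \<open>M - b = (M - c) + (c - b)\<close> and
  \<open>M + b = (M + a) + (b - a)\<close> are sums of nonnegative elements.\<close>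
lemma norm_le_max_if_sandwiched:
  assumes "spectrally_nonneg (b - a)" "spectrally_nonneg (c - b)"
    "a\<^sup>\<star> = a" "b\<^sup>\<star> = b" "c\<^sup>\<star> = c"
  shows "norm b \<le> max (norm a) (norm c)"
proof -
  define M where "M = max (norm a) (norm c)"
  have M: "norm (- c) \<le> M" "norm a \<le> M" "0 \<le> M" by (auto simp: M_def max_def)
  have "spectrally_nonneg ((M *\<^sub>R 1 + - c) + (c - b))"
    using M assms by (intro spectrally_nonneg_add spectrally_nonneg_shift) (auto simp: adj_minus)
  moreover have "spectrally_nonneg ((M *\<^sub>R 1 + a) + (b - a))"
    using M assms by (intro spectrally_nonneg_add spectrally_nonneg_shift)
  ultimately have "norm b \<le> M"
    using norm_le_if_spectrally_between[OF assms(4), of M] M(3) by simp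
  then show ?thesis by (simp add: M_def)
qed

lemma abs_selfadjoint:
  fixes h :: "'a::unital_cstar_algebra"
  assumes "h\<^sup>\<star> = h"
  obtains m where "spectrally_nonneg m" "m\<^sup>\<star> = m" "m * m = h * h"
    "\<And>x. x * h = h * x \<Longrightarrow> x * m = m * x"
    "\<And>I. closed_left_ideal I \<Longrightarrow> h \<in> I \<Longrightarrow> m \<in> I"
proof -
  obtain m where m: "spectrally_nonneg m" "m\<^sup>\<star> = m" "m * m = h * h"
    and comm: "\<And>x. x * (h * h) = (h * h) * x \<Longrightarrow> x * m = m * x"
    and ideal: "\<And>I. closed_left_ideal I \<Longrightarrow> h * h \<in> I \<Longrightarrow> m \<in> I"
    by (rule spectrally_nonneg_sqrt[OF spectrally_nonneg_square[OF assms]]) blast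
  show thesis
  proof (rule that[OF m])
    show "x * m = m * x" if "x * h = h * x" for x
      by (rule comm) (metis that mult.assoc)
    show "m \<in> I" if "closed_left_ideal I" "h \<in> I" for I
      by (rule ideal) (use that in \<open>auto simp: closed_left_ideal_def\<close>)
  qed
qed

lemma spectrally_nonneg_sum_zero:
  assumes "spectrally_nonneg p" "spectrally_nonneg q" "p + q = 0"
  shows "p = 0"
  using assms spectrally_nonneg_antisym[of p] by (simp add: add_eq_0_iff)

section \<open>Positivity of adjoint squares and the Jordan decomposition\<close>

text \<open>Put \<open>h = x\<^sup>\<star> x\<close>.  The element \<open>n = \<bar>h\<bar> - h\<close> is twice the negative part of \<open>h\<close>, and the aim is to show
  that it vanishes.  For \<open>y = x n\<close> one finds \<open>y\<^sup>\<star> y = - w\<^sup>2\<close> with \<open>w\<close> self-adjoint.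
  The usual argument now compares the spectra of \<open>y\<^sup>\<star> y\<close> and \<open>y y\<^sup>\<star>\<close>.  Passing to \<open>z = y w\<close> avoids
  this, since both \<open>z\<^sup>\<star> z = - w\<^sup>4\<close> and \<open>z z\<^sup>\<star> = - (y y\<^sup>\<star>)\<^sup>2\<close> are visibly negatives of squares, while their sum
  is \<open>2 (s\<^sup>2 + t\<^sup>2)\<close> for the real and imaginary parts of \<open>z\<close>.  A sum of squares of self-adjoint
  elements that is zero has only zero terms, so \<open>y y\<^sup>\<star> = 0\<close>.\<close>
theorem spectrally_nonneg_adj_mult_self:
  fixes x :: "'a::unital_cstar_algebra"
  shows "spectrally_nonneg (x\<^sup>\<star> * x)"
proof -
  define h where "h = x\<^sup>\<star> * x"
  have h: "h\<^sup>\<star> = h" by (simp add: h_def adj_mult adj_adj)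
  obtain m where m: "spectrally_nonneg m" "m\<^sup>\<star> = m" "m * m = h * h"
      "\<And>y. y * h = h * y \<Longrightarrow> y * m = m * y"
    by (rule abs_selfadjoint[OF h]) blast
  obtain k where k: "k\<^sup>\<star> = k" "k * k = m" "\<And>y. y * m = m * y \<Longrightarrow> y * k = k * y"
    by (rule spectrally_nonneg_sqrt[OF m(1)]) blast
  define n where "n = m - h"
  have n: "n\<^sup>\<star> = n" by (simp add: n_def adj_diff m(2) h)
  have hm: "h * m = m * h" by (rule m(4)) simp
  have kn: "k * n = n * k"
    using k(3)[of n] by (simp add: n_def algebra_simps hm)
  have mn: "m * n = n * m" by (simp add: n_def algebra_simps hm)
  \<comment> \<open>On the negative part, \<open>h\<close> acts as \<open>- \<bar>h\<bar>\<close>.\<close>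
  have hn: "h * n = - (m * n)" by (simp add: n_def algebra_simps hm m(3))
  have nn: "n * n = 2 *\<^sub>R (m * n)" by (simp add: n_def algebra_simps hm m(3) scaleR_2)
  define w where "w = k * n"
  have w: "w\<^sup>\<star> = w" by (simp add: w_def adj_mult k(1) n kn)
  have ww: "w * w = n * (m * n)" by (metis w_def kn k(2) mult.assoc)
  define y where "y = x * n"
  have yy: "y\<^sup>\<star> * y = - (w * w)"
  proof -
    have "y\<^sup>\<star> * y = n * (h * n)" by (simp add: y_def adj_mult n h_def mult.assoc)
    then show ?thesis by (simp add: hn ww)
  qed
  define K where "K = y * y\<^sup>\<star>"
  have K: "K\<^sup>\<star> = K" by (simp add: K_def adj_mult adj_adj)
  define z where "z = y * w"
  have "z\<^sup>\<star> * z = w * (y\<^sup>\<star> * y) * w" by (simp add: z_def adj_mult w mult.assoc)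
  then have zz1: "z\<^sup>\<star> * z = - ((w * w) * (w * w))" by (simp add: yy mult.assoc)
  have "z * z\<^sup>\<star> = y * (w * w) * y\<^sup>\<star>" by (simp add: z_def adj_mult w mult.assoc)
  also have "w * w = - (y\<^sup>\<star> * y)" by (simp add: yy)
  finally have zz2: "z * z\<^sup>\<star> = - (K * K)" by (simp add: K_def mult.assoc)
  define s t where "s = re_part z" and "t = im_part z"
  have z: "z = s + \<i> *\<^sub>C t" "s\<^sup>\<star> = s" "t\<^sup>\<star> = t"
    using re_im_decomposition[of z] by (simp_all add: s_def t_def)
  then have za: "z\<^sup>\<star> = s - \<i> *\<^sub>C t" by (simp add: adj_add adj_scaleC scaleC_minus_left)
  have "z\<^sup>\<star> * z + z * z\<^sup>\<star> = 2 *\<^sub>R (s * s) + 2 *\<^sub>R (t * t)"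
    unfolding za by (subst (1 2) z(1)) (simp add: algebra_simps mult_scaleC_left mult_scaleC_right
        scaleC_scaleC scaleC_diff_right scaleC_add_right scaleC_minus_left scaleR_2)
  then have st: "2 *\<^sub>R (s * s) + 2 *\<^sub>R (t * t) = - ((w * w) * (w * w)) + - (K * K)"
    unfolding zz1 zz2 by simp
  have "K * K + ((w * w) * (w * w) + (2 *\<^sub>R (s * s) + 2 *\<^sub>R (t * t))) = 0"
    unfolding st by simp
  moreover have "spectrally_nonneg ((w * w) * (w * w) + (2 *\<^sub>R (s * s) + 2 *\<^sub>R (t * t)))"
    by (intro spectrally_nonneg_add spectrally_nonneg_scaleR spectrally_nonneg_square)
       (simp_all add: z w adj_mult)
  ultimately have "K * K = 0"
    using spectrally_nonneg_sum_zero[OF spectrally_nonneg_square[OF K]] by simp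
  then have "K = 0" using K by (simp add: square_eq_zero_selfadjoint)
  then have "y = 0"
    using adj_mult_self_eq_zero_iff[of "y\<^sup>\<star>"] by (metis K_def adj_adj adj_zero)
  then have "w * w = 0" using yy by simp
  then have "n * (m * n) = 0" by (simp add: ww)
  then have "n * (n * n) = 0" by (simp add: nn)
  then have "(n * n) * (n * n) = 0" by (simp add: mult.assoc)
  then have "n = 0" using n by (simp add: square_eq_zero_selfadjoint adj_mult)
  then show ?thesis using m(1) by (simp add: n_def h_def)
qed

text \<open>Here \<open>m\<close> is \<open>\<bar>h\<bar>\<close>, and \<open>n = m - h\<close> satisfies \<open>n\<^sup>2 = 2 m n\<close>, which should force \<open>n \<ge> 0\<close>.  With
  \<open>l = \<bar>n\<bar>\<close> and \<open>v = l - n\<close> (twice the negative part of \<open>n\<close>, so that \<open>n v = - l v\<close>), multiplying by \<open>v\<^sup>2\<close> gives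
  \<open>(l v)\<^sup>2 = - 2 m l v\<^sup>2\<close>: a square that is the negative of a square, as \<open>m\<close>, \<open>l\<close>
  and \<open>v\<close> commute and \<open>m\<close>, \<open>l\<close> have roots.  So \<open>l v = 0\<close>, and \<open>v\<^sup>2 = 2 l v\<close> vanishes as well.\<close>
lemma spectrally_nonneg_abs_minus:
  fixes h :: "'a::unital_cstar_algebra"
  assumes m: "spectrally_nonneg m" and h: "h\<^sup>\<star> = h" and mm: "m * m = h * h" and hm: "h * m = m * h"
  shows "spectrally_nonneg (m - h)"
proof -
  define n where "n = m - h"
  have ma: "m\<^sup>\<star> = m" using m by (rule spectrally_nonneg_selfadjoint)
  have n: "n\<^sup>\<star> = n" by (simp add: n_def adj_diff ma h)
  have nm: "n * m = m * n" by (simp add: n_def algebra_simps hm)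
  have nn: "n * n = 2 *\<^sub>R (m * n)" by (simp add: n_def algebra_simps hm mm scaleR_2)
  obtain l where l: "spectrally_nonneg l" "l\<^sup>\<star> = l" "l * l = n * n"
      "\<And>y. y * n = n * y \<Longrightarrow> y * l = l * y"
    by (rule abs_selfadjoint[OF n]) blast
  define v where "v = l - n"
  have v: "v\<^sup>\<star> = v" by (simp add: v_def adj_diff l(2) n)
  have ln: "l * n = n * l" using l(4)[of n] by simp
  have ml: "m * l = l * m" using l(4)[of m] nm by simp
  have mv: "m * v = v * m" by (simp add: v_def algebra_simps ml nm)
  have lv: "l * v = v * l" by (simp add: v_def algebra_simps ln)
  have nv: "n * v = - (l * v)" by (simp add: v_def algebra_simps ln l(3))
  have vv: "v * v = 2 *\<^sub>R (l * v)" by (simp add: v_def algebra_simps ln l(3) scaleR_2)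
  obtain p where p: "p\<^sup>\<star> = p" "p * p = m" "\<And>y. y * m = m * y \<Longrightarrow> y * p = p * y"
    by (rule spectrally_nonneg_sqrt[OF m]) blast
  obtain q where q: "q\<^sup>\<star> = q" "q * q = l" "\<And>y. y * l = l * y \<Longrightarrow> y * q = q * y"
    by (rule spectrally_nonneg_sqrt[OF l(1)]) blast
  have lp: "l * p = p * l" using p(3)[of l] ml by simp
  have pq: "p * q = q * p" using q(3)[of p] lp by simp
  have vp: "v * p = p * v" using p(3)[of v] mv by simp
  have vq: "v * q = q * v" using q(3)[of v] lv by simp
  define f where "f = p * q * v"
  define g where "g = l * v"
  have fa: "f\<^sup>\<star> = f" by (simp add: f_def adj_mult p(1) q(1) v) (metis pq vp vq mult.assoc)
  have ga: "g\<^sup>\<star> = g" by (simp add: g_def adj_mult l(2) v lv)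
  have ff: "f * f = m * (l * (v * v))"
    unfolding f_def using pq vp vq p(2) q(2) by (metis mult.assoc)
  have "(l * l) * v = 2 *\<^sub>R (m * (n * v))" by (simp add: l(3) nn mult.assoc)
  then have "l * (l * v) = - 2 *\<^sub>R (m * (l * v))" by (simp add: nv mult.assoc)
  then have "l * (l * v) * v = - 2 *\<^sub>R (m * (l * v)) * v" by simp
  then have "g * g = - (2 *\<^sub>R (f * f))"
    unfolding ff g_def using lv by (simp add: mult.assoc) (metis lv mult.assoc)
  then have "g * g + 2 *\<^sub>R (f * f) = 0" by simp
  then have "g * g = 0"
    by (rule spectrally_nonneg_sum_zero[rotated 2])
       (intro spectrally_nonneg_square spectrally_nonneg_scaleR fa ga; simp)+
  then have "l * v = 0" using ga by (simp add: square_eq_zero_selfadjoint g_def)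
  then have "v = 0" using vv v square_eq_zero_selfadjoint[of v] by simp
  then show ?thesis using l(1) by (simp add: v_def n_def)
qed

text \<open>The squares are the positive and negative parts \<open>(\<bar>h\<bar> \<plusminus> h) / 2\<close>, whose norms do not exceed
  that of \<open>h\<close> because \<open>\<bar>h\<bar>\<close> and \<open>h\<close> have the same norm.\<close>
lemma selfadjoint_difference_of_squares:
  fixes h :: "'a::unital_cstar_algebra"
  assumes "h\<^sup>\<star> = h" "closed_left_ideal I" "h \<in> I"
  obtains p q where "p\<^sup>\<star> = p" "q\<^sup>\<star> = q" "h = p * p - q * q" "p \<in> I" "q \<in> I"
    "(norm p)\<^sup>2 \<le> norm h" "(norm q)\<^sup>2 \<le> norm h"
proof -
  obtain m where m: "spectrally_nonneg m" "m\<^sup>\<star> = m" "m * m = h * h"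
    and comm: "\<And>x. x * h = h * x \<Longrightarrow> x * m = m * x" and mI: "m \<in> I"
    by (rule abs_selfadjoint[OF assms(1)]) (use assms in blast)
  have hm: "h * m = m * h" by (rule comm) simp
  have normm: "norm m = norm h"
    using norm_square_selfadjoint[OF m(2)] norm_square_selfadjoint[OF assms(1)] m(3) by simp
  have sub: "subspace I" using assms(2) by (simp add: closed_left_ideal_def)
  \<comment> \<open>Applied to \<open>h\<close> and to \<open>- h\<close>, which have the same absolute value \<open>m\<close>.\<close>
  have half: "\<exists>p. p\<^sup>\<star> = p \<and> p * p = (1/2) *\<^sub>R (m - g) \<and> p \<in> I \<and> (norm p)\<^sup>2 \<le> norm h"
    if g: "g\<^sup>\<star> = g" "g * g = h * h" "g * m = m * g" "g \<in> I" "norm g = norm h" for g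
  proof -
    have "spectrally_nonneg ((1/2) *\<^sub>R (m - g))"
      using g m by (intro spectrally_nonneg_scaleR spectrally_nonneg_abs_minus) auto
    moreover have "(1/2) *\<^sub>R (m - g) \<in> I"
      using sub mI g by (intro subspace_scale subspace_diff)
    ultimately obtain p where p: "p\<^sup>\<star> = p" "p * p = (1/2) *\<^sub>R (m - g)" "p \<in> I"
      using spectrally_nonneg_sqrt assms(2) by metis
    have "(norm p)\<^sup>2 \<le> norm h"
      using norm_square_selfadjoint[OF p(1)] norm_triangle_ineq4[of m g] normm g(5) p(2) by simp
    with p show ?thesis by blast
  qed
  obtain q where q: "q\<^sup>\<star> = q" "q * q = (1/2) *\<^sub>R (m - h)" "q \<in> I" "(norm q)\<^sup>2 \<le> norm h"
    using half[of h] hm assms by auto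
  obtain p where p: "p\<^sup>\<star> = p" "p * p = (1/2) *\<^sub>R (m - (- h))" "p \<in> I" "(norm p)\<^sup>2 \<le> norm h"
    using half[of "- h"] hm assms sub by (auto simp: adj_minus subspace_neg)
  have "p * p - q * q = (1/2) *\<^sub>R (h + h)"
    by (simp add: p q algebra_simps)
  then have "h = p * p - q * q" by (simp flip: scaleR_2)
  then show thesis using that p(1,3,4) q(1,3,4) by blast
qed

section \<open>The multiplier algebra\<close>

text \<open>The algebra is regarded as a Hilbert module over itself with inner product \<open>x\<^sup>\<star> y\<close>.  The operators
  with an adjoint in this sense form a unital \<open>C\<^sup>*\<close>-algebra, and the algebra acts on itself by
  left multiplication.\<close>
definition has_adjoint :: "('a::cstar_algebra \<Rightarrow>\<^sub>L 'a) \<Rightarrow> ('a \<Rightarrow>\<^sub>L 'a) \<Rightarrow> bool"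
  where "has_adjoint T T' \<longleftrightarrow> (\<forall>x y. (T x)\<^sup>\<star> * y = x\<^sup>\<star> * T' y)"

lemma eq_if_right_mult_eq: "(\<And>y. (x::'a::cstar_algebra)\<^sup>\<star> * y = z\<^sup>\<star> * y) \<Longrightarrow> x = z"
  using adj_mult_self_eq_zero_iff[of "x - z"] by (simp add: adj_diff left_diff_distrib)

lemma has_adjoint_sym: "has_adjoint T T' \<Longrightarrow> has_adjoint T' T"
  unfolding has_adjoint_def by (metis adj_adj adj_mult)

lemma has_adjoint_unique:
  assumes "has_adjoint T T'" "has_adjoint T T''"
  shows "T' = T''"
proof (rule blinfun_eqI, rule eq_if_right_mult_eq)
  show "(T' x)\<^sup>\<star> * y = (T'' x)\<^sup>\<star> * y" for x y
    using assms[THEN has_adjoint_sym] by (simp add: has_adjoint_def)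
qed

lemma has_adjoint_scaleC_apply:
  assumes "has_adjoint T T'"
  shows "T (c *\<^sub>C x) = c *\<^sub>C T x"
  by (rule eq_if_right_mult_eq) (use assms in \<open>simp add: has_adjoint_def adj_scaleC mult_scaleC_left\<close>)

lemma has_adjoint_mult_apply:
  assumes "has_adjoint T T'"
  shows "T (x * y) = T x * y"
  by (rule eq_if_right_mult_eq) (use assms in \<open>simp add: has_adjoint_def adj_mult mult.assoc\<close>)

lemma has_adjoint_zero: "has_adjoint 0 0"
  by (simp add: has_adjoint_def)

lemma has_adjoint_id: "has_adjoint id_blinfun id_blinfun"
  by (simp add: has_adjoint_def)

lemma has_adjoint_add: "has_adjoint S S' \<Longrightarrow> has_adjoint T T' \<Longrightarrow> has_adjoint (S + T) (S' + T')"
  by (simp add: has_adjoint_def blinfun.add_left adj_add distrib_left distrib_right)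

lemma has_adjoint_scaleC: "has_adjoint T T' \<Longrightarrow> has_adjoint (c *\<^sub>C T) (cnj c *\<^sub>C T')"
  by (simp add: has_adjoint_def scaleC_blinfun.rep_eq adj_scaleC mult_scaleC_left mult_scaleC_right)

lemma has_adjoint_scaleR: "has_adjoint T T' \<Longrightarrow> has_adjoint (r *\<^sub>R T) (r *\<^sub>R T')"
  by (simp add: has_adjoint_def blinfun.scaleR_left adj_scaleR)

lemma has_adjoint_minus: "has_adjoint T T' \<Longrightarrow> has_adjoint (- T) (- T')"
  using has_adjoint_scaleR[of T T' "-1"] by simp

lemma has_adjoint_diff: "has_adjoint S S' \<Longrightarrow> has_adjoint T T' \<Longrightarrow> has_adjoint (S - T) (S' - T')"
  using has_adjoint_add[OF _ has_adjoint_minus] by fastforce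

lemma has_adjoint_compose:
  "has_adjoint S S' \<Longrightarrow> has_adjoint T T' \<Longrightarrow> has_adjoint (S o\<^sub>L T) (T' o\<^sub>L S')"
  by (simp add: has_adjoint_def)

text \<open>The \<open>C\<^sup>*\<close>-identity for the vectors \<open>T x\<close> turns \<open>norm (T x)\<close> squared into the norm of
  \<open>x\<^sup>\<star> (T' T x)\<close>.\<close>
lemma has_adjoint_norm_power2_le:
  assumes "has_adjoint T T'"
  shows "(norm T)\<^sup>2 \<le> norm (T' o\<^sub>L T)"
proof -
  have "norm (T x) \<le> sqrt (norm (T' o\<^sub>L T)) * norm x" for x
  proof -
    have "(norm (T x))\<^sup>2 = norm (x\<^sup>\<star> * (T' o\<^sub>L T) x)"
      using assms by (simp add: has_adjoint_def flip: cstar_identity)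
    also have "\<dots> \<le> norm x * (norm (T' o\<^sub>L T) * norm x)"
      using norm_mult_ineq[of "x\<^sup>\<star>" "(T' o\<^sub>L T) x"] norm_blinfun[of "T' o\<^sub>L T" x]
      by (simp add: order_trans mult_left_mono)
    also have "\<dots> = (sqrt (norm (T' o\<^sub>L T)) * norm x)\<^sup>2"
      by (simp add: power_mult_distrib) (simp add: power2_eq_square)
    finally show ?thesis by (rule power2_le_imp_le) simp
  qed
  then have "norm T \<le> sqrt (norm (T' o\<^sub>L T))" by (intro norm_blinfun_bound) auto
  then have "(norm T)\<^sup>2 \<le> (sqrt (norm (T' o\<^sub>L T)))\<^sup>2" by (intro power_mono) auto
  then show ?thesis by simp
qed

lemma has_adjoint_norm:
  assumes "has_adjoint T T'"
  shows "norm T' = norm T"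
proof -
  have "norm S \<le> norm S'" if "has_adjoint S S'" for S S' :: "'a \<Rightarrow>\<^sub>L 'a"
    using order_trans[OF has_adjoint_norm_power2_le[OF that] norm_blinfun_compose[of S' S]]
    by (cases "norm S = 0") (simp_all add: power2_eq_square)
  from this[OF assms] this[OF has_adjoint_sym[OF assms]] show ?thesis by simp
qed

lemma has_adjoint_cstar_identity:
  assumes "has_adjoint T T'"
  shows "norm (T' o\<^sub>L T) = (norm T)\<^sup>2"
  using has_adjoint_norm_power2_le[OF assms] norm_blinfun_compose[of T' T] has_adjoint_norm[OF assms]
  by (simp add: power2_eq_square)

lemma has_adjoint_limit:
  assumes "\<And>n. has_adjoint (X n) (X' n)" "X \<longlonglongrightarrow> T" "X' \<longlonglongrightarrow> T'"
  shows "has_adjoint T T'"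
  unfolding has_adjoint_def
proof (intro allI)
  fix x y
  have "(\<lambda>n. (X n x)\<^sup>\<star> * y) \<longlonglongrightarrow> (T x)\<^sup>\<star> * y"
    by (intro tendsto_intros bounded_linear.tendsto[OF bounded_linear_adj] assms)
  moreover have "(\<lambda>n. x\<^sup>\<star> * X' n y) \<longlonglongrightarrow> x\<^sup>\<star> * T' y"
    by (intro tendsto_intros assms)
  moreover have "(X n x)\<^sup>\<star> * y = x\<^sup>\<star> * X' n y" for n
    using assms(1) by (simp add: has_adjoint_def)
  ultimately show "(T x)\<^sup>\<star> * y = x\<^sup>\<star> * T' y" using LIMSEQ_unique by simp
qed

typedef (overloaded) 'a multiplier = "{T :: 'a::cstar_algebra \<Rightarrow>\<^sub>L 'a. \<exists>T'. has_adjoint T T'}"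
  morphisms multiplier_apply Multiplier
  using has_adjoint_zero by blast

setup_lifting type_definition_multiplier

instantiation multiplier :: (cstar_algebra) real_normed_vector
begin

lift_definition zero_multiplier :: "'a multiplier" is 0
  using has_adjoint_zero by blast
lift_definition plus_multiplier :: "'a multiplier \<Rightarrow> 'a multiplier \<Rightarrow> 'a multiplier" is "(+)"
  using has_adjoint_add by blast
lift_definition minus_multiplier :: "'a multiplier \<Rightarrow> 'a multiplier \<Rightarrow> 'a multiplier" is "(-)"
  using has_adjoint_diff by blast
lift_definition uminus_multiplier :: "'a multiplier \<Rightarrow> 'a multiplier" is uminus
  using has_adjoint_minus by blast
lift_definition scaleR_multiplier :: "real \<Rightarrow> 'a multiplier \<Rightarrow> 'a multiplier" is "(*\<^sub>R)"
  using has_adjoint_scaleR by blast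
lift_definition norm_multiplier :: "'a multiplier \<Rightarrow> real" is norm .
definition dist_multiplier :: "'a multiplier \<Rightarrow> 'a multiplier \<Rightarrow> real"
  where "dist_multiplier S T = norm (S - T)"
definition sgn_multiplier :: "'a multiplier \<Rightarrow> 'a multiplier"
  where "sgn_multiplier T = inverse (norm T) *\<^sub>R T"
definition [code del]:
  "(uniformity :: ('a multiplier \<times> 'a multiplier) filter) = (INF e\<in>{0<..}. principal {(x, y). dist x y < e})"
definition open_multiplier :: "'a multiplier set \<Rightarrow> bool"
  where [code del]: "open_multiplier U = (\<forall>x\<in>U. \<forall>\<^sub>F (x', y) in uniformity. x' = x \<longrightarrow> y \<in> U)"

instance
proof
  fix S T U :: "'a multiplier" and r s :: real
  show "S + T + U = S + (T + U)" by transfer (rule add.assoc)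
  show "S + T = T + S" by transfer (rule add.commute)
  show "0 + T = T" by transfer simp
  show "- T + T = 0" by transfer simp
  show "S - T = S + - T" by transfer simp
  show "r *\<^sub>R (S + T) = r *\<^sub>R S + r *\<^sub>R T" by transfer (rule scaleR_add_right)
  show "(r + s) *\<^sub>R T = r *\<^sub>R T + s *\<^sub>R T" by transfer (rule scaleR_add_left)
  show "r *\<^sub>R s *\<^sub>R T = (r * s) *\<^sub>R T" by transfer simp
  show "1 *\<^sub>R T = T" by transfer simp
  show "(norm T = 0) = (T = 0)" by transfer simp
  show "norm (S + T) \<le> norm S + norm T" by transfer (rule norm_triangle_ineq)
  show "norm (r *\<^sub>R T) = \<bar>r\<bar> * norm T" by transfer simp
qed (simp_all add: dist_multiplier_def sgn_multiplier_def uniformity_multiplier_def open_multiplier_def)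

end

instantiation multiplier :: (cstar_algebra) real_normed_algebra
begin

lift_definition times_multiplier :: "'a multiplier \<Rightarrow> 'a multiplier \<Rightarrow> 'a multiplier" is "(o\<^sub>L)"
  using has_adjoint_compose by blast

instance
proof
  fix S T U :: "'a multiplier" and r :: real
  show "S * T * U = S * (T * U)" by transfer (rule blinfun_eqI, simp)
  show "(S + T) * U = S * U + T * U"
    by transfer (rule blinfun_eqI, simp add: blinfun.add_left)
  show "S * (T + U) = S * T + S * U"
    by transfer (rule blinfun_eqI, simp add: blinfun.add_left blinfun.add_right)
  show "r *\<^sub>R S * T = r *\<^sub>R (S * T)"
    by transfer (rule blinfun_eqI, simp add: blinfun.scaleR_left)
  show "S * r *\<^sub>R T = r *\<^sub>R (S * T)"
    by transfer (rule blinfun_eqI, simp add: blinfun.scaleR_left blinfun.scaleR_right)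
  show "norm (S * T) \<le> norm S * norm T" by transfer (rule norm_blinfun_compose)
qed

end

instantiation multiplier :: (cstar_algebra) monoid_mult
begin

lift_definition one_multiplier :: "'a multiplier" is id_blinfun
  using has_adjoint_id by blast

instance by standard (transfer, rule blinfun_eqI, simp)+

end

instantiation multiplier :: (cstar_algebra) complex_normed_vector
begin

lift_definition scaleC_multiplier :: "complex \<Rightarrow> 'a multiplier \<Rightarrow> 'a multiplier" is "(*\<^sub>C)"
  using has_adjoint_scaleC by blast

instance
proof
  fix S T :: "'a multiplier" and c d :: complex and r :: real
  show "c *\<^sub>C (S + T) = c *\<^sub>C S + c *\<^sub>C T" by transfer (rule scaleC_add_right)
  show "(c + d) *\<^sub>C T = c *\<^sub>C T + d *\<^sub>C T" by transfer (rule scaleC_add_left)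
  show "c *\<^sub>C d *\<^sub>C T = (c * d) *\<^sub>C T" by transfer (rule scaleC_scaleC)
  show "complex_of_real r *\<^sub>C T = r *\<^sub>R T" by transfer (rule scaleC_of_real)
  show "norm (c *\<^sub>C T) = cmod c * norm T" by transfer (rule norm_scaleC)
qed

end

lemma dist_multiplier_apply: "dist (multiplier_apply S) (multiplier_apply T) = dist S T"
  unfolding dist_norm by transfer simp

lemma adjoint_of_multiplier: "\<exists>T'. has_adjoint (multiplier_apply T) (multiplier_apply T')"
proof -
  obtain T' where "has_adjoint (multiplier_apply T) T'" using multiplier_apply[of T] by blast
  then show ?thesis using has_adjoint_sym by (metis Multiplier_inverse mem_Collect_eq)
qed

text \<open>Along a Cauchy sequence of multipliers the adjoints form a Cauchy sequence too, and the two
  limits in operator norm are adjoint to each other.\<close>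
instance multiplier :: (cstar_algebra) banach
proof
  fix X :: "nat \<Rightarrow> 'a multiplier"
  assume X: "Cauchy X"
  define X' where "X' n = (SOME T'. has_adjoint (multiplier_apply (X n)) (multiplier_apply T'))" for n
  have adj: "has_adjoint (multiplier_apply (X n)) (multiplier_apply (X' n))" for n
    unfolding X'_def by (rule someI_ex[OF adjoint_of_multiplier])
  have "dist (multiplier_apply (X' m)) (multiplier_apply (X' n)) = dist (X m) (X n)" for m n
    unfolding dist_multiplier_apply[of "X m" "X n", symmetric]
    using has_adjoint_norm[OF has_adjoint_diff[OF adj adj]] by (simp add: dist_norm)
  then have "Cauchy (\<lambda>n. multiplier_apply (X n))" "Cauchy (\<lambda>n. multiplier_apply (X' n))"
    using X by (simp_all add: Cauchy_def dist_multiplier_apply)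
  then obtain T T' where lim: "(\<lambda>n. multiplier_apply (X n)) \<longlonglongrightarrow> T" "(\<lambda>n. multiplier_apply (X' n)) \<longlonglongrightarrow> T'"
    using Cauchy_convergent convergent_def by metis
  then have "has_adjoint T T'" using adj by (rule has_adjoint_limit[rotated])
  then have "multiplier_apply (Multiplier T) = T" by (intro Multiplier_inverse) blast
  then have "X \<longlonglongrightarrow> Multiplier T"
    using lim(1) by (simp add: lim_sequentially flip: dist_multiplier_apply)
  then show "convergent X" by (auto simp: convergent_def)
qed

instantiation multiplier :: (cstar_algebra) unital_cstar_algebra
begin

definition adj_multiplier :: "'a multiplier \<Rightarrow> 'a multiplier"
  where "adj_multiplier T = (SOME T'. has_adjoint (multiplier_apply T) (multiplier_apply T'))"

lemma has_adjoint_adj: "has_adjoint (multiplier_apply T) (multiplier_apply (T\<^sup>\<star>))"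
  unfolding adj_multiplier_def by (rule someI_ex[OF adjoint_of_multiplier])

lemma multiplier_adj_eqI: "has_adjoint (multiplier_apply T) (multiplier_apply T') \<Longrightarrow> T\<^sup>\<star> = T'"
  using has_adjoint_unique[OF has_adjoint_adj] multiplier_apply_inject by blast

instance
proof
  fix S T :: "'a multiplier" and c :: complex
  show "c *\<^sub>C S * T = c *\<^sub>C (S * T)"
    by transfer (rule blinfun_eqI, simp add: scaleC_blinfun.rep_eq)
  show "S * c *\<^sub>C T = c *\<^sub>C (S * T)"
    by transfer (rule blinfun_eqI, auto simp: scaleC_blinfun.rep_eq has_adjoint_scaleC_apply)
  show "(T\<^sup>\<star>)\<^sup>\<star> = T"
    by (rule multiplier_adj_eqI, rule has_adjoint_sym, rule has_adjoint_adj)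
  show "(S + T)\<^sup>\<star> = S\<^sup>\<star> + T\<^sup>\<star>"
    by (rule multiplier_adj_eqI) (simp add: plus_multiplier.rep_eq has_adjoint_add has_adjoint_adj)
  show "(c *\<^sub>C T)\<^sup>\<star> = cnj c *\<^sub>C T\<^sup>\<star>"
    by (rule multiplier_adj_eqI) (simp add: scaleC_multiplier.rep_eq has_adjoint_scaleC has_adjoint_adj)
  show "(S * T)\<^sup>\<star> = T\<^sup>\<star> * S\<^sup>\<star>"
    by (rule multiplier_adj_eqI) (simp add: times_multiplier.rep_eq has_adjoint_compose has_adjoint_adj)
  show "norm (T\<^sup>\<star> * T) = (norm T)\<^sup>2"
    using has_adjoint_cstar_identity[OF has_adjoint_adj[of T]]
    by (simp add: norm_multiplier.rep_eq times_multiplier.rep_eq)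
qed

end

lift_definition left_mult :: "'a::cstar_algebra \<Rightarrow> 'a multiplier" is blinfun_mult_right
  subgoal for a
    by (rule exI[of _ "blinfun_mult_right (a\<^sup>\<star>)"]) (simp add: has_adjoint_def adj_mult mult.assoc)
  done

lemma left_mult_apply [simp]: "multiplier_apply (left_mult a) x = a * x"
  by (simp add: left_mult.rep_eq)

lemma multiplier_eqI: "(\<And>x. multiplier_apply S x = multiplier_apply T x) \<Longrightarrow> S = T"
  by (metis blinfun_eqI multiplier_apply_inject)

lemma left_mult_add: "left_mult (a + b) = left_mult a + left_mult b"
  by (rule multiplier_eqI) (simp add: plus_multiplier.rep_eq blinfun.add_left distrib_right)

lemma left_mult_diff: "left_mult (a - b) = left_mult a - left_mult b"
  by (rule multiplier_eqI) (simp add: minus_multiplier.rep_eq blinfun.diff_left left_diff_distrib)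

lemma left_mult_scaleR: "left_mult (r *\<^sub>R a) = r *\<^sub>R left_mult a"
  by (rule multiplier_eqI) (simp add: scaleR_multiplier.rep_eq blinfun.scaleR_left)

lemma left_mult_mult: "left_mult (a * b) = left_mult a * left_mult b"
  by (rule multiplier_eqI) (simp add: times_multiplier.rep_eq mult.assoc)

lemma left_mult_adj: "left_mult (a\<^sup>\<star>) = (left_mult a)\<^sup>\<star>"
  by (rule multiplier_adj_eqI[symmetric]) (simp add: has_adjoint_def adj_mult mult.assoc)

lemma multiplier_mult_left_mult: "T * left_mult a = left_mult (multiplier_apply T a)"
  using has_adjoint_mult_apply[OF has_adjoint_adj[of T]]
  by (intro multiplier_eqI) (simp add: times_multiplier.rep_eq)

text \<open>The lower bound is the \<open>C\<^sup>*\<close>-identity for \<open>a a\<^sup>\<star>\<close>, that is, evaluation at \<open>a\<^sup>\<star>\<close>.\<close>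
lemma norm_left_mult [simp]: "norm (left_mult a) = norm a"
proof (rule antisym)
  show "norm (left_mult a) \<le> norm a"
    by (simp add: norm_multiplier.rep_eq left_mult.rep_eq norm_blinfun_bound norm_mult_ineq)
  show "norm a \<le> norm (left_mult a)"
    using norm_blinfun[of "multiplier_apply (left_mult a)" "a\<^sup>\<star>"] cstar_identity[of "a\<^sup>\<star>"]
    by (cases "a = 0") (simp_all add: adj_adj power2_eq_square norm_multiplier.rep_eq)
qed

text \<open>Left multiplication is isometric, so its range is complete; \<open>T\<close> composed with multiplication by \<open>a\<close>
  is multiplication by \<open>T a\<close>.\<close>
lemma closed_left_ideal_range_left_mult: "closed_left_ideal (range left_mult)"
proof -
  have lin: "bounded_linear (left_mult :: 'a \<Rightarrow> 'a multiplier)"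
    by (rule bounded_linear_intro[where K = 1]) (simp_all add: left_mult_add left_mult_scaleR)
  then have "complete (range (left_mult :: 'a \<Rightarrow> 'a multiplier))"
    by (intro complete_isometric_image[where e = 1]) (simp_all add: complete_UNIV)
  moreover have "subspace (range (left_mult :: 'a \<Rightarrow> 'a multiplier))"
    by (rule linear_subspace_image) (use lin in \<open>simp_all add: bounded_linear.linear\<close>)
  ultimately show ?thesis
    by (auto simp: closed_left_ideal_def complete_eq_closed multiplier_mult_left_mult)
qed

section \<open>Order intervals of elements\<close>

lemma left_mult_inject: "left_mult a = left_mult b \<longleftrightarrow> a = b"
  using norm_left_mult[of "a - b"] by (auto simp: left_mult_diff)

text \<open>The decomposition takes place in the multiplier algebra, with square roots inside the ideal that
  the algebra forms there.\<close>
theorem selfadjoint_eq_diff_positives: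
  fixes a :: "'a::cstar_algebra"
  assumes "a\<^sup>\<star> = a"
  obtains x y where "a = x\<^sup>\<star> * x - y\<^sup>\<star> * y" "(norm x)\<^sup>2 \<le> norm a" "(norm y)\<^sup>2 \<le> norm a"
proof -
  have "(left_mult a)\<^sup>\<star> = left_mult a" using assms by (simp flip: left_mult_adj)
  then obtain p q where pq: "p\<^sup>\<star> = p" "q\<^sup>\<star> = q" "left_mult a = p * p - q * q"
      "p \<in> range left_mult" "q \<in> range left_mult" "(norm p)\<^sup>2 \<le> norm a" "(norm q)\<^sup>2 \<le> norm a"
    using selfadjoint_difference_of_squares[OF _ closed_left_ideal_range_left_mult rangeI]
      norm_left_mult by metis
  then obtain x y where xy: "p = left_mult x" "q = left_mult y" by blast
  have "left_mult a = left_mult (x\<^sup>\<star> * x - y\<^sup>\<star> * y)"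
    using pq xy by (simp add: left_mult_diff left_mult_mult left_mult_adj)
  then show thesis using that[of x y] pq xy by (simp add: left_mult_inject)
qed

theorem norm_le_max_if_between:
  fixes a b c :: "'a::cstar_algebra"
  assumes "a\<^sup>\<star> = a" "b\<^sup>\<star> = b" "c\<^sup>\<star> = c" "b - a \<in> positives" "c - b \<in> positives"
  shows "norm b \<le> max (norm a) (norm c)"
proof -
  have pos: "spectrally_nonneg (left_mult p)" if p: "p \<in> positives" for p :: 'a
  proof -
    obtain x where "p = x\<^sup>\<star> * x" using p by (auto simp: positives_def)
    then show ?thesis
      using spectrally_nonneg_adj_mult_self[of "left_mult x"] by (simp add: left_mult_mult left_mult_adj)
  qed
  show ?thesis
    using norm_le_max_if_sandwiched[of "left_mult b" "left_mult a" "left_mult c"]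
      assms(1-3) pos[OF assms(4)] pos[OF assms(5)]
    by (simp add: left_mult_diff flip: left_mult_adj)
qed

lemma selfadjoint_if_positive: "p \<in> positives \<Longrightarrow> p\<^sup>\<star> = p"
  by (auto simp: positives_def adj_mult adj_adj)

lemma zero_positive: "0 \<in> positives"
  by (auto simp: positives_def intro!: exI[of _ 0])

lemma norm_le_if_parts_between:
  fixes a :: "'a::cstar_algebra"
  assumes "re_part a - re_part b1 \<in> positives" "re_part b2 - re_part a \<in> positives"
    "im_part a - im_part b3 \<in> positives" "im_part b4 - im_part a \<in> positives"
  shows "norm a \<le> max (norm b1) (norm b2) + max (norm b3) (norm b4)"
proof -
  have "norm (re_part a) \<le> max (norm (re_part b1)) (norm (re_part b2))"
    "norm (im_part a) \<le> max (norm (im_part b3)) (norm (im_part b4))"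
    using assms by (simp_all add: norm_le_max_if_between)
  moreover have "norm a \<le> norm (re_part a) + norm (im_part a)"
    using norm_triangle_ineq[of "re_part a" "\<i> *\<^sub>C im_part a"] re_im_decomposition[of a]
    by (simp add: norm_scaleC)
  ultimately show ?thesis
    using norm_re_part[of b1] norm_re_part[of b2] norm_im_part[of b3] norm_im_part[of b4]
    by linarith
qed

text \<open>Positive elements are self-adjoint, so an order relation modulo \<open>\<i> A\<^sub>s\<^sub>a\<close> is one between the real
  parts, and an order relation up to the factor \<open>\<i>\<close> modulo \<open>A\<^sub>s\<^sub>a\<close> is one between the imaginary parts.\<close>
lemma norm_le_if_in_complex_order_interval:
  fixes a :: "'a::cstar_algebra"
  assumes "a \<in> {b1 + p + \<i> *\<^sub>C s | p s. p \<in> positives \<and> s \<in> selfadjoints}"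
    "a \<in> {b2 - p + \<i> *\<^sub>C s | p s. p \<in> positives \<and> s \<in> selfadjoints}"
    "a \<in> {b3 + \<i> *\<^sub>C p + s | p s. p \<in> positives \<and> s \<in> selfadjoints}"
    "a \<in> {b4 - \<i> *\<^sub>C p + s | p s. p \<in> positives \<and> s \<in> selfadjoints}"
  shows "norm a \<le> max (norm b1) (norm b2) + max (norm b3) (norm b4)"
proof -
  note parts = re_part_add im_part_add re_part_diff im_part_diff re_part_imaginary im_part_imaginary
    re_part_selfadjoint im_part_selfadjoint selfadjoint_if_positive
  obtain p s where 1: "a = b1 + p + \<i> *\<^sub>C s" "p \<in> positives" "s\<^sup>\<star> = s"
    using assms(1) by (auto simp: selfadjoints_def)
  have "re_part a - re_part b1 = p" using 1 by (simp add: parts)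
  moreover obtain q t where 2: "a = b2 - q + \<i> *\<^sub>C t" "q \<in> positives" "t\<^sup>\<star> = t"
    using assms(2) by (auto simp: selfadjoints_def)
  have "re_part b2 - re_part a = q" using 2 by (simp add: parts)
  moreover obtain p' s' where 3: "a = b3 + \<i> *\<^sub>C p' + s'" "p' \<in> positives" "s'\<^sup>\<star> = s'"
    using assms(3) by (auto simp: selfadjoints_def)
  have "im_part a - im_part b3 = p'" using 3 by (simp add: parts)
  moreover obtain q' t' where 4: "a = b4 - \<i> *\<^sub>C q' + t'" "q' \<in> positives" "t'\<^sup>\<star> = t'"
    using assms(4) by (auto simp: selfadjoints_def)
  have "im_part b4 - im_part a = q'" using 4 by (simp add: parts)
  ultimately show ?thesis using 1(2) 2(2) 3(2) 4(2) by (intro norm_le_if_parts_between) simp_all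
qed

section \<open>Order intervals of functionals\<close>

text \<open>Splitting \<open>a\<close> into its positive and negative parts costs nothing in norm: the upper bound
  is used on the one and the lower bound on the other.\<close>
lemma additive_le_if_bounded_on_positives:
  fixes f :: "'a::cstar_algebra \<Rightarrow> real"
  assumes "a\<^sup>\<star> = a" "\<And>x y. f (x - y) = f x - f y" "0 \<le> K" "0 \<le> L"
    and "\<And>x. f (x\<^sup>\<star> * x) \<le> K * (norm x)\<^sup>2" "\<And>x. - (L * (norm x)\<^sup>2) \<le> f (x\<^sup>\<star> * x)"
  shows "f a \<le> (L + K) * norm a"
proof -
  obtain x y where a: "a = x\<^sup>\<star> * x - y\<^sup>\<star> * y" and le: "(norm x)\<^sup>2 \<le> norm a" "(norm y)\<^sup>2 \<le> norm a"
    using selfadjoint_eq_diff_positives[OF assms(1)] by blast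
  have "f a = f (x\<^sup>\<star> * x) - f (y\<^sup>\<star> * y)" by (subst a) (rule assms(2))
  also have "\<dots> \<le> K * (norm x)\<^sup>2 + L * (norm y)\<^sup>2"
    using assms(5)[of x] assms(6)[of y] by linarith
  also have "\<dots> \<le> K * norm a + L * norm a"
    using le assms(3,4) by (intro add_mono mult_left_mono)
  finally show ?thesis by (simp add: algebra_simps)
qed

lemma dual_space_scaleC: "\<phi> \<in> dual_space \<Longrightarrow> \<phi> (c *\<^sub>C x) = c * \<phi> x"
  by (simp add: dual_space_def)

lemma norm_apply_adj_mult_self: "cmod (blinfun_apply \<phi> (x\<^sup>\<star> * x)) \<le> norm \<phi> * (norm x)\<^sup>2"
  for x :: "'a::cstar_algebra"
  using norm_blinfun[of \<phi> "x\<^sup>\<star> * x"] by (simp add: cstar_identity)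

text \<open>Multiplying \<open>x\<close> by a phase makes \<open>\<psi> x\<close> nonnegative.  Then only the real part of \<open>\<psi> (a - \<i> b)\<close> counts,
  for self-adjoint \<open>a\<close> and \<open>b\<close> of norm at most \<open>norm x\<close>, and that is \<open>Re (\<psi> a) + Im (\<psi> b)\<close>.\<close>
lemma norm_le_if_bounded_on_selfadjoints:
  assumes \<psi>: "\<psi> \<in> dual_space" and KL: "0 \<le> K" "0 \<le> L"
    and re: "\<And>a. a\<^sup>\<star> = a \<Longrightarrow> Re (\<psi> a) \<le> K * norm a"
    and im: "\<And>a. a\<^sup>\<star> = a \<Longrightarrow> Im (\<psi> a) \<le> L * norm a"
  shows "norm \<psi> \<le> K + L"
proof (rule norm_blinfun_bound)
  fix x
  \<comment> \<open>If \<open>\<psi> x = 0\<close> then \<open>w = 0\<close>, which is harmless as only \<open>cmod w \<le> 1\<close> matters.\<close>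
  define w where "w = cnj (sgn (\<psi> x))"
  define a b where "a = re_part (w *\<^sub>C x)" and "b = - im_part (w *\<^sub>C x)"
  have wx: "w *\<^sub>C x = a + (- \<i>) *\<^sub>C b"
    using re_im_decomposition[of "w *\<^sub>C x"]
    by (simp add: a_def b_def scaleC_minus_left scaleC_minus_right)
  have "cmod w \<le> 1" by (simp add: w_def norm_sgn)
  then have "norm (w *\<^sub>C x) \<le> norm x" by (simp add: norm_scaleC mult_left_le_one_le)
  then have ab: "norm a \<le> norm x" "norm b \<le> norm x"
    using norm_re_part[of "w *\<^sub>C x"] norm_im_part[of "w *\<^sub>C x"] by (simp_all add: a_def b_def)
  have "w * \<psi> x = \<psi> x * cnj (\<psi> x) / cmod (\<psi> x)" by (simp add: w_def sgn_eq)
  also have "\<dots> = cmod (\<psi> x)"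
    by (simp only: complex_norm_square[symmetric]) (simp add: power2_eq_square)
  finally have "complex_of_real (cmod (\<psi> x)) = w * \<psi> x" by simp
  also have "\<dots> = \<psi> (w *\<^sub>C x)" using \<psi> by (simp add: dual_space_scaleC)
  also have "\<dots> = \<psi> a - \<i> * \<psi> b"
    unfolding wx using \<psi> by (simp add: blinfun.add_right dual_space_scaleC)
  finally have "cmod (\<psi> x) = Re (\<psi> a - \<i> * \<psi> b)" by (metis Re_complex_of_real)
  also have "\<dots> = Re (\<psi> a) + Im (\<psi> b)" by simp
  also have "\<dots> \<le> K * norm a + L * norm b"
    using re[of a] im[of b] by (simp add: a_def b_def adj_minus)
  also have "\<dots> \<le> K * norm x + L * norm x"
    using ab KL by (intro add_mono mult_left_mono)
  finally show "norm (\<psi> x) \<le> (K + L) * norm x" by (simp add: algebra_simps)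
qed (use KL in simp)

lemma real_if_selfadjoint_functional:
  assumes "\<sigma> \<in> dual_selfadjoints" "a\<^sup>\<star> = a"
  shows "Im (\<sigma> a) = 0"
proof -
  have "\<sigma> (a\<^sup>\<star>) = cnj (\<sigma> a)" using assms(1) by (simp add: dual_selfadjoints_def)
  then have "\<sigma> a = cnj (\<sigma> a)" by (simp add: assms(2))
  then show ?thesis by (simp add: complex_eq_iff)
qed

lemma positive_functional_apply:
  assumes "p \<in> dual_positives"
  shows "Im (p (x\<^sup>\<star> * x)) = 0" "0 \<le> Re (p (x\<^sup>\<star> * x))"
  using assms by (auto simp: dual_positives_def complex_nonneg_Reals_iff)

lemma zero_dual_selfadjoint: "0 \<in> dual_selfadjoints"
  by (simp add: dual_selfadjoints_def dual_space_def)

lemma dual_space_add: "\<phi> \<in> dual_space \<Longrightarrow> \<psi> \<in> dual_space \<Longrightarrow> \<phi> + \<psi> \<in> dual_space"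
  by (simp add: dual_space_def blinfun.add_left distrib_left)

lemma dual_space_scaleC_blinfun: "\<phi> \<in> dual_space \<Longrightarrow> c *\<^sub>C \<phi> \<in> dual_space"
  by (simp add: dual_space_def scaleC_blinfun.rep_eq scaleC_complex_def mult.left_commute)

text \<open>All the order relations between functionals take this form: positive functionals are
  nonnegative on \<open>x\<^sup>\<star> x\<close>, and adding a self-adjoint functional changes only the real parts there.\<close>
lemma norm_le_if_between_on_positives:
  fixes \<psi> \<phi>1 \<phi>2 \<phi>3 \<phi>4 :: "'a::cstar_algebra \<Rightarrow>\<^sub>L complex"
  assumes \<psi>: "\<psi> \<in> dual_space"
    and re: "\<And>x. Re (\<phi>1 (x\<^sup>\<star> * x)) \<le> Re (\<psi> (x\<^sup>\<star> * x))" "\<And>x. Re (\<psi> (x\<^sup>\<star> * x)) \<le> Re (\<phi>2 (x\<^sup>\<star> * x))"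
    and im: "\<And>x. Im (\<phi>3 (x\<^sup>\<star> * x)) \<le> Im (\<psi> (x\<^sup>\<star> * x))" "\<And>x. Im (\<psi> (x\<^sup>\<star> * x)) \<le> Im (\<phi>4 (x\<^sup>\<star> * x))"
  shows "norm \<psi> \<le> (norm \<phi>1 + norm \<phi>2) + (norm \<phi>3 + norm \<phi>4)"
proof (rule norm_le_if_bounded_on_selfadjoints[OF \<psi>])
  have b: "\<bar>Re (\<phi> (x\<^sup>\<star> * x))\<bar> \<le> norm \<phi> * (norm x)\<^sup>2" "\<bar>Im (\<phi> (x\<^sup>\<star> * x))\<bar> \<le> norm \<phi> * (norm x)\<^sup>2"
    for \<phi> :: "'a \<Rightarrow>\<^sub>L complex" and x
    using norm_apply_adj_mult_self[of \<phi> x] abs_Re_le_cmod abs_Im_le_cmod order_trans by blast+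
  fix a :: 'a
  assume a: "a\<^sup>\<star> = a"
  show "Re (\<psi> a) \<le> (norm \<phi>1 + norm \<phi>2) * norm a"
  proof (rule additive_le_if_bounded_on_positives[OF a])
    show "Re (\<psi> (x\<^sup>\<star> * x)) \<le> norm \<phi>2 * (norm x)\<^sup>2" for x using re(2)[of x] b(1)[of \<phi>2 x] by linarith
    show "- (norm \<phi>1 * (norm x)\<^sup>2) \<le> Re (\<psi> (x\<^sup>\<star> * x))" for x using re(1)[of x] b(1)[of \<phi>1 x] by linarith
  qed (simp_all add: blinfun.diff_right)
  show "Im (\<psi> a) \<le> (norm \<phi>3 + norm \<phi>4) * norm a"
  proof (rule additive_le_if_bounded_on_positives[OF a])
    show "Im (\<psi> (x\<^sup>\<star> * x)) \<le> norm \<phi>4 * (norm x)\<^sup>2" for x using im(2)[of x] b(2)[of \<phi>4 x] by linarith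
    show "- (norm \<phi>3 * (norm x)\<^sup>2) \<le> Im (\<psi> (x\<^sup>\<star> * x))" for x using im(1)[of x] b(2)[of \<phi>3 x] by linarith
  qed (simp_all add: blinfun.diff_right)
qed simp_all

lemma norm_le_if_in_complex_dual_order_interval:
  assumes \<phi>1: "\<phi>1 \<in> dual_space"
    and \<psi>: "\<psi> \<in> {\<phi>1 + p + \<i> *\<^sub>C s | p s. p \<in> dual_positives \<and> s \<in> dual_selfadjoints}"
      "\<psi> \<in> {\<phi>2 - p + \<i> *\<^sub>C s | p s. p \<in> dual_positives \<and> s \<in> dual_selfadjoints}"
      "\<psi> \<in> {\<phi>3 + \<i> *\<^sub>C p + s | p s. p \<in> dual_positives \<and> s \<in> dual_selfadjoints}"
      "\<psi> \<in> {\<phi>4 - \<i> *\<^sub>C p + s | p s. p \<in> dual_positives \<and> s \<in> dual_selfadjoints}"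
  shows "norm \<psi> \<le> norm \<phi>1 + norm \<phi>2 + norm \<phi>3 + norm \<phi>4"
proof -
  note ev = blinfun.add_left blinfun.diff_left scaleC_blinfun.rep_eq scaleC_complex_def
    positive_functional_apply real_if_selfadjoint_functional adj_mult adj_adj
  obtain p s where 1: "\<psi> = \<phi>1 + p + \<i> *\<^sub>C s" "p \<in> dual_positives" "s \<in> dual_selfadjoints"
    using \<psi>(1) by blast
  obtain q t where 2: "\<psi> = \<phi>2 - q + \<i> *\<^sub>C t" "q \<in> dual_positives" "t \<in> dual_selfadjoints"
    using \<psi>(2) by blast
  obtain p' s' where 3: "\<psi> = \<phi>3 + \<i> *\<^sub>C p' + s'" "p' \<in> dual_positives" "s' \<in> dual_selfadjoints"
    using \<psi>(3) by blast
  obtain q' t' where 4: "\<psi> = \<phi>4 - \<i> *\<^sub>C q' + t'" "q' \<in> dual_positives" "t' \<in> dual_selfadjoints"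
    using \<psi>(4) by blast
  have "\<psi> \<in> dual_space"
    using 1 \<phi>1 by (simp add: dual_positives_def dual_selfadjoints_def dual_space_add dual_space_scaleC_blinfun)
  then have "norm \<psi> \<le> (norm \<phi>1 + norm \<phi>2) + (norm \<phi>3 + norm \<phi>4)"
  proof (rule norm_le_if_between_on_positives)
    fix x
    show "Re (\<phi>1 (x\<^sup>\<star> * x)) \<le> Re (\<psi> (x\<^sup>\<star> * x))"
      using 1(2,3) by (simp add: 1(1) ev)
    show "Re (\<psi> (x\<^sup>\<star> * x)) \<le> Re (\<phi>2 (x\<^sup>\<star> * x))"
      using 2(2,3) by (simp add: 2(1) ev)
    show "Im (\<phi>3 (x\<^sup>\<star> * x)) \<le> Im (\<psi> (x\<^sup>\<star> * x))"
      using 3(2,3) by (simp add: 3(1) ev)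
    show "Im (\<psi> (x\<^sup>\<star> * x)) \<le> Im (\<phi>4 (x\<^sup>\<star> * x))"
      using 4(2,3) by (simp add: 4(1) ev)
  qed
  then show ?thesis by simp
qed

lemma norm_le_if_dual_between:
  fixes \<rho> \<phi> \<psi> :: "'a::cstar_algebra \<Rightarrow>\<^sub>L complex"
  assumes "\<rho> \<sqsubseteq>\<^sub>D \<phi>" "\<phi> \<sqsubseteq>\<^sub>D \<psi>" and \<phi>: "\<phi> \<in> dual_selfadjoints"
  shows "norm \<phi> \<le> norm \<rho> + norm \<psi>"
proof -
  obtain p where p: "\<phi> = \<rho> + p" "p \<in> dual_positives" using assms(1) by (auto simp: dual_le_def)
  obtain q where q: "\<psi> = \<phi> + q" "q \<in> dual_positives" using assms(2) by (auto simp: dual_le_def)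
  have "norm \<phi> \<le> (norm \<rho> + norm \<psi>) + (norm (0 :: 'a \<Rightarrow>\<^sub>L complex) + norm (0 :: 'a \<Rightarrow>\<^sub>L complex))"
  proof (rule norm_le_if_between_on_positives)
    show "\<phi> \<in> dual_space" using \<phi> by (simp add: dual_selfadjoints_def)
    fix x
    show "Re (\<rho> (x\<^sup>\<star> * x)) \<le> Re (\<phi> (x\<^sup>\<star> * x))"
      using p(2) by (simp add: p(1) blinfun.add_left positive_functional_apply)
    show "Re (\<phi> (x\<^sup>\<star> * x)) \<le> Re (\<psi> (x\<^sup>\<star> * x))"
      using q(2) by (simp add: q(1) blinfun.add_left positive_functional_apply)
  qed (simp_all add: real_if_selfadjoint_functional[OF \<phi>] adj_mult adj_adj)
  then show ?thesis by simp
qed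

theorem theorem5p3:
  shows "
      (\<forall>b1 b2 b3 b4 a :: 'a::cstar_algebra.
        a \<in> {b1 + p + \<i> *\<^sub>C s | p s. p \<in> positives \<and> s \<in> selfadjoints}
          \<inter> {b2 - p + \<i> *\<^sub>C s | p s. p \<in> positives \<and> s \<in> selfadjoints}
          \<inter> {b3 + \<i> *\<^sub>C p + s | p s. p \<in> positives \<and> s \<in> selfadjoints}
          \<inter> {b4 - \<i> *\<^sub>C p + s | p s. p \<in> positives \<and> s \<in> selfadjoints}
        \<longrightarrow> norm a \<le> max (norm b1) (norm b2) + max (norm b3) (norm b4))
    \<and> (\<forall>b1 b2 b3 b4 a :: 'a.
        a \<in> {b1 + p | p. p \<in> positives}
          \<inter> {b2 - p | p. p \<in> positives}
          \<inter> {b3 + \<i> *\<^sub>C p | p. p \<in> positives}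
          \<inter> {b4 - \<i> *\<^sub>C p | p. p \<in> positives}
        \<longrightarrow> norm a \<le> max (norm b1) (norm b2) + max (norm b3) (norm b4))
    \<and> (\<forall>a b c :: 'a. a \<sqsubseteq>\<^sub>A b \<and> b \<sqsubseteq>\<^sub>A c
        \<longrightarrow> norm b \<le> 2 * max (norm a) (norm c))
    \<and> (\<forall>a\<in>selfadjoints. \<forall>b\<in>selfadjoints. \<forall>c\<in>selfadjoints :: 'a set. a \<sqsubseteq>\<^sub>A b \<and> b \<sqsubseteq>\<^sub>A c
        \<longrightarrow> norm b \<le> max (norm a) (norm c))
    \<and> (\<forall>\<phi>1\<in>dual_space. \<forall>\<phi>2\<in>dual_space. \<forall>\<phi>3\<in>dual_space. \<forall>\<phi>4\<in>dual_space. \<forall>\<psi> :: 'a \<Rightarrow>\<^sub>L complex.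
        \<psi> \<in> {\<phi>1 + p + \<i> *\<^sub>C s | p s. p \<in> dual_positives \<and> s \<in> dual_selfadjoints}
          \<inter> {\<phi>2 - p + \<i> *\<^sub>C s | p s. p \<in> dual_positives \<and> s \<in> dual_selfadjoints}
          \<inter> {\<phi>3 + \<i> *\<^sub>C p + s | p s. p \<in> dual_positives \<and> s \<in> dual_selfadjoints}
          \<inter> {\<phi>4 - \<i> *\<^sub>C p + s | p s. p \<in> dual_positives \<and> s \<in> dual_selfadjoints}
        \<longrightarrow> norm \<psi> \<le> norm \<phi>1 + norm \<phi>2 + norm \<phi>3 + norm \<phi>4)
    \<and> (\<forall>\<phi>1\<in>dual_space. \<forall>\<phi>2\<in>dual_space. \<forall>\<phi>3\<in>dual_space. \<forall>\<phi>4\<in>dual_space. \<forall>\<psi> :: 'a \<Rightarrow>\<^sub>L complex.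
        \<psi> \<in> {\<phi>1 + p | p. p \<in> dual_positives}
          \<inter> {\<phi>2 - p | p. p \<in> dual_positives}
          \<inter> {\<phi>3 + \<i> *\<^sub>C p | p. p \<in> dual_positives}
          \<inter> {\<phi>4 - \<i> *\<^sub>C p | p. p \<in> dual_positives}
        \<longrightarrow> norm \<psi> \<le> norm \<phi>1 + norm \<phi>2 + norm \<phi>3 + norm \<phi>4)
    \<and> (\<forall>\<rho>\<in>dual_space. \<forall>\<phi>\<in>dual_space. \<forall>\<psi>\<in>dual_space :: ('a \<Rightarrow>\<^sub>L complex) set. \<rho> \<sqsubseteq>\<^sub>D \<phi> \<and> \<phi> \<sqsubseteq>\<^sub>D \<psi>
        \<longrightarrow> norm \<phi> \<le> 2 * (norm \<rho> + norm \<psi>))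
    \<and> (\<forall>\<rho>\<in>dual_selfadjoints. \<forall>\<phi>\<in>dual_selfadjoints. \<forall>\<psi>\<in>dual_selfadjoints :: ('a \<Rightarrow>\<^sub>L complex) set.
        \<rho> \<sqsubseteq>\<^sub>D \<phi> \<and> \<phi> \<sqsubseteq>\<^sub>D \<psi> \<longrightarrow> norm \<phi> \<le> norm \<rho> + norm \<psi>)"
proof (intro conjI allI ballI impI)
  fix b1 b2 b3 b4 a :: 'a
  assume "a \<in> {b1 + p + \<i> *\<^sub>C s | p s. p \<in> positives \<and> s \<in> selfadjoints}
      \<inter> {b2 - p + \<i> *\<^sub>C s | p s. p \<in> positives \<and> s \<in> selfadjoints}
      \<inter> {b3 + \<i> *\<^sub>C p + s | p s. p \<in> positives \<and> s \<in> selfadjoints}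
      \<inter> {b4 - \<i> *\<^sub>C p + s | p s. p \<in> positives \<and> s \<in> selfadjoints}"
  then show "norm a \<le> max (norm b1) (norm b2) + max (norm b3) (norm b4)"
    by (intro norm_le_if_in_complex_order_interval) blast+
next
  fix b1 b2 b3 b4 a :: 'a
  assume "a \<in> {b1 + p | p. p \<in> positives} \<inter> {b2 - p | p. p \<in> positives}
      \<inter> {b3 + \<i> *\<^sub>C p | p. p \<in> positives} \<inter> {b4 - \<i> *\<^sub>C p | p. p \<in> positives}"
  then obtain p q p' q' where "a = b1 + p" "p \<in> positives" "a = b2 - q" "q \<in> positives"
      "a = b3 + \<i> *\<^sub>C p'" "p' \<in> positives" "a = b4 - \<i> *\<^sub>C q'" "q' \<in> positives"
    by blast
  \<comment> \<open>The self-adjoint summands of the previous case are chosen to be \<open>0\<close>.\<close>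
  moreover have "(0 :: 'a) \<in> selfadjoints" by (simp add: selfadjoints_def)
  ultimately show "norm a \<le> max (norm b1) (norm b2) + max (norm b3) (norm b4)"
    by (intro norm_le_if_in_complex_order_interval) (force intro: exI[of _ 0])+
next
  fix a b c :: 'a
  assume "a \<sqsubseteq>\<^sub>A b \<and> b \<sqsubseteq>\<^sub>A c"
  then obtain p q where b: "b = a + p" "p \<in> positives" and c: "c = b + q" "q \<in> positives"
    by (auto simp: alg_le_def)
  have "norm b \<le> max (norm a) (norm c) + max (norm a) (norm c)"
  proof (rule norm_le_if_parts_between)
    show "re_part b - re_part a \<in> positives" "re_part c - re_part b \<in> positives"
      using b c by (simp_all add: re_part_add re_part_selfadjoint selfadjoint_if_positive)
    \<comment> \<open>All three elements have the same imaginary part.\<close>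
    show "im_part b - im_part a \<in> positives" "im_part c - im_part b \<in> positives"
      using b c by (simp_all add: im_part_add im_part_selfadjoint selfadjoint_if_positive zero_positive)
  qed
  then show "norm b \<le> 2 * max (norm a) (norm c)" by simp
next
  fix a b c :: 'a
  assume "a \<in> selfadjoints" "b \<in> selfadjoints" "c \<in> selfadjoints" "a \<sqsubseteq>\<^sub>A b \<and> b \<sqsubseteq>\<^sub>A c"
  then show "norm b \<le> max (norm a) (norm c)"
    by (intro norm_le_max_if_between) (auto simp: selfadjoints_def alg_le_def)
next
  fix \<phi>1 \<phi>2 \<phi>3 \<phi>4 \<psi> :: "'a \<Rightarrow>\<^sub>L complex"
  assume "\<phi>1 \<in> dual_space"
    and "\<psi> \<in> {\<phi>1 + p + \<i> *\<^sub>C s | p s. p \<in> dual_positives \<and> s \<in> dual_selfadjoints}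
      \<inter> {\<phi>2 - p + \<i> *\<^sub>C s | p s. p \<in> dual_positives \<and> s \<in> dual_selfadjoints}
      \<inter> {\<phi>3 + \<i> *\<^sub>C p + s | p s. p \<in> dual_positives \<and> s \<in> dual_selfadjoints}
      \<inter> {\<phi>4 - \<i> *\<^sub>C p + s | p s. p \<in> dual_positives \<and> s \<in> dual_selfadjoints}"
  then show "norm \<psi> \<le> norm \<phi>1 + norm \<phi>2 + norm \<phi>3 + norm \<phi>4"
    by (intro norm_le_if_in_complex_dual_order_interval) blast+
next
  fix \<phi>1 \<phi>2 \<phi>3 \<phi>4 \<psi> :: "'a \<Rightarrow>\<^sub>L complex"
  assume \<phi>1: "\<phi>1 \<in> dual_space"
    and "\<psi> \<in> {\<phi>1 + p | p. p \<in> dual_positives} \<inter> {\<phi>2 - p | p. p \<in> dual_positives}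
      \<inter> {\<phi>3 + \<i> *\<^sub>C p | p. p \<in> dual_positives} \<inter> {\<phi>4 - \<i> *\<^sub>C p | p. p \<in> dual_positives}"
  then obtain p q p' q' where "\<psi> = \<phi>1 + p" "p \<in> dual_positives" "\<psi> = \<phi>2 - q" "q \<in> dual_positives"
      "\<psi> = \<phi>3 + \<i> *\<^sub>C p'" "p' \<in> dual_positives" "\<psi> = \<phi>4 - \<i> *\<^sub>C q'" "q' \<in> dual_positives"
    by blast
  with \<phi>1 show "norm \<psi> \<le> norm \<phi>1 + norm \<phi>2 + norm \<phi>3 + norm \<phi>4"
    by (intro norm_le_if_in_complex_dual_order_interval)
       (force intro: exI[of _ 0] zero_dual_selfadjoint)+
next
  fix \<rho> \<phi> \<psi> :: "'a \<Rightarrow>\<^sub>L complex"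
  assume \<rho>: "\<rho> \<in> dual_space" and le: "\<rho> \<sqsubseteq>\<^sub>D \<phi> \<and> \<phi> \<sqsubseteq>\<^sub>D \<psi>"
  obtain p q where p: "\<phi> = \<rho> + p" "p \<in> dual_positives" and q: "\<psi> = \<phi> + q" "q \<in> dual_positives"
    using le by (auto simp: dual_le_def)
  have "\<phi> \<in> dual_space" using \<rho> p by (simp add: dual_space_add dual_positives_def)
  then have "norm \<phi> \<le> (norm \<rho> + norm \<psi>) + (norm \<rho> + norm \<psi>)"
    by (rule norm_le_if_between_on_positives)
       (use p(2) q(2) in \<open>simp_all add: p(1) q(1) blinfun.add_left positive_functional_apply\<close>)
  then show "norm \<phi> \<le> 2 * (norm \<rho> + norm \<psi>)" by simp
next
  fix \<rho> \<phi> \<psi> :: "'a \<Rightarrow>\<^sub>L complex"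
  assume "\<phi> \<in> dual_selfadjoints" "\<rho> \<sqsubseteq>\<^sub>D \<phi> \<and> \<phi> \<sqsubseteq>\<^sub>D \<psi>"
  then show "norm \<phi> \<le> norm \<rho> + norm \<psi>"
    using norm_le_if_dual_between by blast
qed

end
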